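(* Let $0\le\alpha\le1$, $n\ge1$, $V\ge0$ and $\sigma>0$. The least squares estimator $\hat\mu$ over the cone $\mathcal F(\mathcal T_{\alpha,n})$ of flows on the tree $\mathcal T_{\alpha,n}$ satisfies $$\sup_{\mu\in\mathcal F(\mathcal T_{\alpha,n}):\,\mu_1\le V}\ \mathbb E\,\frac1n\|\hat\mu-\mu\|^2\ \le\ 2\Bigl(\frac{\sigma^2V\log(en)}{n}\Bigr)^{2/3}+\frac{\sigma^2\log(en)}{n^{1-\alpha}}.$$
   Context: For $0\le\alpha\le1$ and a positive integer $n$, put $m=\lceil n^\alpha\rceil$ and $l=\lceil n^{1-\alpha}\rceil$. The rooted tree $\mathcal T_{\alpha,n}$ has a root with $m$ children, each of which is the first vertex of a path with $l$ vertices; it has $lm+1=\Theta(n)$ vertices. A flow $\mu$ on it consists of a root value $\mu_1$ and values $\mu^{(j)}_i$ ($1\le j\le m$, $1\le i\le l$) along the paths; the set of flows $\mathcal F(\mathcal T_{\alpha,n})$ is the closed convex cone defined by $\mu_1\ge\sum_{j=1}^m\mu^{(j)}_1$ and $\mu^{(j)}_1\ge\mu^{(j)}_2\ge\cdots\ge\mu^{(j)}_l\ge0$ for each $j$. The data are $Y=\mu+\epsilon$ with one independent $N(0,\sigma^2)$ error at each vertex. The least squares estimator $\hat\mu$ is the Euclidean projection of $Y$ onto $\mathcal F(\mathcal T_{\alpha,n})$. $\|\cdot\|$ is the Euclidean norm over all vertices, $e$ inside $\log(en)$ is Euler's number, and $\mathbb E$ is expectation under the true $\mu$. *)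

theory Defs
  imports "HOL-Probability.Probability"
begin

definition num_paths :: "real \<Rightarrow> nat \<Rightarrow> nat" where
  "num_paths \<alpha> n = nat \<lceil>real n powr \<alpha>\<rceil>"

definition path_length :: "real \<Rightarrow> nat \<Rightarrow> nat" where
  "path_length \<alpha> n = nat \<lceil>real n powr (1 - \<alpha>)\<rceil>"

text \<open>\<open>Node j i\<close> is the \<open>i\<close>-th vertex, counted from the root, of the \<open>j\<close>-th path; both indices
  start at 1.\<close>

datatype vertex = Root | Node nat nat

definition tree_vertices :: "real \<Rightarrow> nat \<Rightarrow> vertex set" where
  "tree_vertices \<alpha> n =
     insert Root {Node j i | j i. j \<in> {1..num_paths \<alpha> n} \<and> i \<in> {1..path_length \<alpha> n}}"

text \<open>A vector indexed by the vertices of the tree is a function \<open>vertex \<Rightarrow> real\<close> that vanishes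
  outside \<open>tree_vertices \<alpha> n\<close>; the first conjunct says that a flow is such a vector.\<close>

definition flows :: "real \<Rightarrow> nat \<Rightarrow> (vertex \<Rightarrow> real) set" where
  "flows \<alpha> n =
     {\<mu>. (\<forall>v. v \<notin> tree_vertices \<alpha> n \<longrightarrow> \<mu> v = 0) \<and>
         \<mu> Root \<ge> (\<Sum>j = 1..num_paths \<alpha> n. \<mu> (Node j 1)) \<and>
         (\<forall>j \<in> {1..num_paths \<alpha> n}.
            (\<forall>i \<in> {1..<path_length \<alpha> n}. \<mu> (Node j i) \<ge> \<mu> (Node j (i + 1))) \<and>
            \<mu> (Node j (path_length \<alpha> n)) \<ge> 0)}"

definition tree_norm :: "real \<Rightarrow> nat \<Rightarrow> (vertex \<Rightarrow> real) \<Rightarrow> real" where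
  "tree_norm \<alpha> n x = L2_set x (tree_vertices \<alpha> n)"

text \<open>The Euclidean projection of \<open>y\<close> onto the cone of flows. For \<open>n \<ge> 1\<close> the cone is a nonempty
  closed convex subset of a finite-dimensional Euclidean space, so that the minimiser selected by
  \<^const>\<open>arg_min_on\<close> exists and is unique. Only the values of \<open>y\<close> on the vertices matter.\<close>

definition lse :: "real \<Rightarrow> nat \<Rightarrow> (vertex \<Rightarrow> real) \<Rightarrow> (vertex \<Rightarrow> real)" where
  "lse \<alpha> n y = arg_min_on (\<lambda>\<theta>. tree_norm \<alpha> n (\<lambda>v. y v - \<theta> v)) (flows \<alpha> n)"

end

theory Submission
  imports Defs
begin

text \<open>
  The variational inequality for the projection gives, for every flow \<open>\<nu>\<close>, the oracle bound
  \<open>\<parallel>\<theta> - \<mu>\<parallel>\<^sup>2 \<le> \<parallel>\<nu> - \<mu>\<parallel>\<^sup>2 + (2\<langle>\<epsilon>, \<theta> - \<nu>\<rangle> - \<parallel>\<theta> - \<nu>\<parallel>\<^sup>2)\<close> for the estimator \<open>\<theta>\<close>. If \<open>w\<close> is nonnegative and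
  nonincreasing along a list of \<open>r\<close> vertices, slicing \<open>w\<close> horizontally bounds \<open>2\<langle>\<epsilon>, w\<rangle> - \<parallel>w\<parallel>\<^sup>2\<close> by
  \<open>2 \<integral> max\<^sub>k (S\<^sub>k - a k) da\<close> over \<open>a \<ge> 0\<close>, where \<open>S\<^sub>k\<close> are the partial sums of the noise. By Spitzer's identity,
  which is proved by averaging over cyclic rotations, its expectation is \<open>\<sigma>\<^sup>2 H\<^sub>r / 2\<close>; a merely
  monotone \<open>w\<close> costs twice as much.

  When \<open>V\<close> is small, take \<open>\<nu> = 0\<close> and append the first path to the root, so that the root is almost
  free. Otherwise round the \<open>j\<close>-th path to \<open>q\<^sub>j\<close> equidistant positive levels and zero, leave the root
  unconstrained, and choose \<open>q\<^sub>j\<close> to balance the rounding error against the number of levels.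
  The constant 2 leaves just enough room for the ceilings: \<open>l m\<close> can be as large as \<open>2 n\<close>.
\<close>

section \<open>Maxima of walks and Spitzer's identity\<close>

text \<open>The largest prefix sum, the empty prefix included: a prefix is empty or begins with the
  first step.\<close>

fun walk_max :: "real list \<Rightarrow> real" where
  "walk_max [] = 0"
| "walk_max (x # xs) = max 0 (x + walk_max xs)"

lemma walk_max_nonneg: "0 \<le> walk_max xs"
  by (cases xs) auto

lemma sum_list_le_walk_max: "sum_list xs \<le> walk_max xs"
  by (induction xs) auto

text \<open>Appending a step adds just one new prefix, the whole list.\<close>

lemma walk_max_snoc: "walk_max (xs @ [x]) = max (walk_max xs) (sum_list xs + x)"
  by (induction xs) auto

text \<open>A full turn is the identity, so the shift only moves the first summand to the
  end.\<close>

lemma sum_rotate_shift: "(\<Sum>c<length xs. g (rotate (Suc c) xs)) = (\<Sum>c<length xs. g (rotate c xs))"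
  for g :: "'a list \<Rightarrow> 'b::comm_monoid_add"
proof (cases "length xs")
  case (Suc k)
  have "(\<Sum>c<Suc k. g (rotate (Suc c) xs)) = (\<Sum>c<k. g (rotate (Suc c) xs)) + g (rotate (Suc k) xs)"
    by simp
  also have "rotate (Suc k) xs = xs"
    using Suc rotate_conv_mod[of "Suc k" xs] by simp
  also have "(\<Sum>c<k. g (rotate (Suc c) xs)) + g xs = (\<Sum>c<Suc k. g (rotate c xs))"
    by (subst sum.lessThan_Suc_shift) (simp add: add.commute)
  finally show ?thesis using Suc by simp
qed simp

lemma sum_list_rotate: "sum_list (rotate c xs) = sum_list xs" for xs :: "real list"
proof (induction c)
  case (Suc c)
  have "sum_list (rotate1 ys) = sum_list ys" for ys :: "real list"
    by (cases ys) auto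
  with Suc show ?case by simp
qed simp

lemma sum_hd_rotate: "(\<Sum>c<length xs. hd (rotate c xs)) = sum_list xs" for xs :: "real list"
proof (cases "xs = []")
  case False
  then have "(\<Sum>c<length xs. hd (rotate c xs)) = (\<Sum>c<length xs. xs ! c)"
    by (intro sum.cong) (auto simp: hd_rotate_conv_nth)
  then show ?thesis by (simp add: sum_list_sum_nth atLeast0LessThan)
qed simp

text \<open>Spitzer's identity before taking expectations. If the total is positive, the maximum over a
  nonempty prefix starts with the first step; otherwise the last step is irrelevant.\<close>

lemma walk_max_rotate:
  "(\<Sum>c<length xs. walk_max (rotate c xs))
    = (\<Sum>c<length xs. walk_max (butlast (rotate c xs))) + max 0 (sum_list xs)"
proof (cases "sum_list xs > 0")
  case False
  have "walk_max (rotate c xs) = walk_max (butlast (rotate c xs))" for c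
  proof (cases "rotate c xs" rule: rev_cases)
    case (snoc ys y)
    then have "sum_list ys + y \<le> 0"
      using False snoc sum_list_rotate[of c xs] by simp
    then show ?thesis
      using snoc walk_max_nonneg[of ys] by (simp add: walk_max_snoc)
  qed simp
  then show ?thesis using False by simp
next
  case True
  \<comment> \<open>The positive total makes the outer maximum with 0 void, and the tail of one
    rotation is the next rotation without its last entry.\<close>
  have "walk_max (rotate c xs) = hd (rotate c xs) + walk_max (butlast (rotate (Suc c) xs))" for c
  proof (cases "rotate c xs")
    case Nil
    then show ?thesis using True by simp
  next
    case (Cons y ys)
    then have "y + walk_max ys > 0"
      using True Cons sum_list_rotate[of c xs] sum_list_le_walk_max[of ys] by simp
    then show ?thesis
      using Cons by simp
  qed
  then have "(\<Sum>c<length xs. walk_max (rotate c xs))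
      = sum_list xs + (\<Sum>c<length xs. walk_max (butlast (rotate (Suc c) xs)))"
    by (simp only: sum.distrib sum_hd_rotate)
  also have "(\<Sum>c<length xs. walk_max (butlast (rotate (Suc c) xs)))
      = (\<Sum>c<length xs. walk_max (butlast (rotate c xs)))"
    by (rule sum_rotate_shift)
  finally show ?thesis using True by simp
qed

text \<open>This is the supremum of 2<x,w> - |w|^2 over nonnegative nonincreasing w, that is, the
  squared norm of the projection of \<open>xs\<close> onto that cone. Values in
  \<open>ennreal\<close> dispense with integrability arguments.\<close>

definition drift_area :: "real list \<Rightarrow> ennreal" where
  "drift_area xs =
     (\<integral>\<^sup>+a. ennreal (2 * walk_max (map (\<lambda>x. x - a) xs)) * indicator {0..} a \<partial>lborel)"

lemma borel_measurable_walk_max [measurable (raw)]: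
  assumes "\<And>v. v \<in> set vs \<Longrightarrow> f v \<in> borel_measurable M"
  shows "(\<lambda>x. walk_max (map (\<lambda>v. f v x) vs)) \<in> borel_measurable M"
  using assms by (induction vs) auto

lemma borel_measurable_walk_max_drift [measurable]:
  "(\<lambda>a. walk_max (map (\<lambda>x. x - a) xs)) \<in> borel_measurable borel"
  by (rule borel_measurable_walk_max) auto

text \<open>The walk maximum is jointly measurable in the noise and the height, so integrating out
  the height keeps measurability.\<close>

lemma borel_measurable_drift_area:
  assumes [measurable]: "\<And>v. v \<in> set vs \<Longrightarrow> f v \<in> borel_measurable M"
  shows "(\<lambda>x. drift_area (map (\<lambda>v. f v x) vs)) \<in> borel_measurable M"
proof -
  have "(\<lambda>p. walk_max (map (\<lambda>v. f v (fst p) - snd p) vs)) \<in> borel_measurable (M \<Otimes>\<^sub>M lborel)"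
    by (rule borel_measurable_walk_max) auto
  then have [measurable]: "(\<lambda>(x, a). walk_max (map (\<lambda>v. f v x - a) vs)) \<in> borel_measurable (M \<Otimes>\<^sub>M lborel)"
    by (simp add: case_prod_unfold)
  show ?thesis
    unfolding drift_area_def map_map o_def by measurable
qed

text \<open>For positive \<open>s\<close> the region under the integrand is a triangle of height
  \<open>2 * s\<close> over a base of length \<open>s / n\<close>.\<close>

lemma nn_integral_pos_part_drift:
  assumes "0 < n"
  shows "(\<integral>\<^sup>+a. ennreal (2 * max 0 (s - real n * a)) * indicator {0..} a \<partial>lborel)
    = ennreal ((max 0 s)\<^sup>2 / real n)"
proof (cases "0 < s")
  case False
  have zero: "ennreal (2 * max 0 (s - real n * a)) * indicator {0..} a = 0" for a
    using False mult_nonneg_nonneg[of "real n" a]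
    by (cases "0 \<le> a") (auto simp: max_def simp del: mult_nonneg_nonneg)
  show ?thesis
    unfolding zero using False by (simp add: max_def)
next
  case True
  let ?b = "s / real n"
  have "(\<integral>\<^sup>+a. ennreal (2 * max 0 (s - real n * a)) * indicator {0..} a \<partial>lborel)
      = (\<integral>\<^sup>+a. ennreal (2 * (s - real n * a)) * indicator {0..?b} a \<partial>lborel)"
    using assms True by (intro nn_integral_cong) (auto simp: indicator_def max_def field_simps)
  also have "\<dots> = (2 * s * ?b - real n * ?b\<^sup>2) - (2 * s * 0 - real n * 0\<^sup>2)"
    by (rule nn_integral_FTC_Icc)
       (use assms True in \<open>auto intro!: derivative_eq_intros simp: field_simps\<close>)
  also have "\<dots> = ennreal ((max 0 s)\<^sup>2 / real n)"
    using assms True by (simp add: max_def field_simps power2_eq_square)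
  finally show ?thesis .
qed

text \<open>\<open>walk_max_rotate\<close> is applied to the steps lowered by \<open>a\<close> and
  integrated over \<open>a\<close>. The total drops by \<open>length xs * a\<close>, which produces
  the triangle just computed.\<close>

lemma drift_area_rotate:
  assumes "xs \<noteq> []"
  shows "(\<Sum>c<length xs. drift_area (rotate c xs))
    = (\<Sum>c<length xs. drift_area (butlast (rotate c xs)))
      + ennreal ((max 0 (sum_list xs))\<^sup>2 / real (length xs))"
proof -
  let ?W = "\<lambda>xs a. walk_max (map (\<lambda>x. x - a) xs)"
  have eq: "(\<Sum>c<length xs. ?W (rotate c xs) a)
      = (\<Sum>c<length xs. ?W (butlast (rotate c xs)) a) + max 0 (sum_list xs - real (length xs) * a)" for a
    using walk_max_rotate[of "map (\<lambda>x. x - a) xs"]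
    by (simp add: rotate_map map_butlast sum_list_subtractf sum_list_const_mult sum_list_triv)
  have "(\<Sum>c<length xs. drift_area (rotate c xs))
      = (\<integral>\<^sup>+a. (\<Sum>c<length xs. ennreal (2 * ?W (rotate c xs) a) * indicator {0..} a) \<partial>lborel)"
    unfolding drift_area_def by (subst nn_integral_sum) auto
  also have "\<dots> = (\<integral>\<^sup>+a. (\<Sum>c<length xs. ennreal (2 * ?W (butlast (rotate c xs)) a) * indicator {0..} a)
      + ennreal (2 * max 0 (sum_list xs - real (length xs) * a)) * indicator {0..} a \<partial>lborel)"
  proof (rule nn_integral_cong)
    fix a :: real
    have "(\<Sum>c<length xs. ennreal (2 * ?W (rotate c xs) a)) = ennreal (2 * (\<Sum>c<length xs. ?W (rotate c xs) a))"
      by (simp add: walk_max_nonneg sum_distrib_left sum_ennreal)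
    also have "\<dots> = ennreal (2 * (\<Sum>c<length xs. ?W (butlast (rotate c xs)) a)
        + 2 * max 0 (sum_list xs - real (length xs) * a))"
      by (simp add: eq algebra_simps)
    also have "\<dots> = (\<Sum>c<length xs. ennreal (2 * ?W (butlast (rotate c xs)) a))
        + ennreal (2 * max 0 (sum_list xs - real (length xs) * a))"
      by (simp add: walk_max_nonneg sum_nonneg sum_distrib_left sum_ennreal ennreal_plus)
    finally show "(\<Sum>c<length xs. ennreal (2 * ?W (rotate c xs) a) * indicator {0..} a)
      = (\<Sum>c<length xs. ennreal (2 * ?W (butlast (rotate c xs)) a) * indicator {0..} a)
      + ennreal (2 * max 0 (sum_list xs - real (length xs) * a)) * indicator {0..} a"
      by (simp add: sum_distrib_right[symmetric] distrib_right)
  qed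
  also have "\<dots> = (\<Sum>c<length xs. drift_area (butlast (rotate c xs)))
      + ennreal ((max 0 (sum_list xs))\<^sup>2 / real (length xs))"
    unfolding drift_area_def
    by (subst nn_integral_add, measurable, subst nn_integral_sum, measurable)
       (use assms in \<open>simp add: nn_integral_pos_part_drift\<close>)
  finally show ?thesis .
qed

text \<open>Once an entry of \<open>w\<close> falls below \<open>a\<close>, so do all later ones;
  hence the left side is one of the prefix sums.\<close>

lemma level_sum_le_walk_max:
  fixes x w :: "'i \<Rightarrow> real"
  assumes "sorted_wrt (\<lambda>u v. w v \<le> w u) vs"
  shows "(\<Sum>v\<leftarrow>vs. if a \<le> w v then x v - a else 0) \<le> walk_max (map (\<lambda>x. x - a) (map x vs))"
  using assms
proof (induction vs)
  case (Cons u vs)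
  show ?case
  proof (cases "a \<le> w u")
    case True
    then show ?thesis using Cons by auto
  next
    case False
    then have "(\<Sum>v\<leftarrow>vs. if a \<le> w v then x v - a else 0) = (\<Sum>v\<leftarrow>vs. 0)"
      using Cons.prems by (intro arg_cong[of _ _ sum_list] map_cong) force+
    then show ?thesis using False by simp
  qed
qed simp

text \<open>Layer-cake decomposition: at each height \<open>a\<close> the superlevel set of \<open>w\<close> is a prefix of the list.\<close>

lemma quadratic_le_drift_area:
  fixes x w :: "'i \<Rightarrow> real"
  assumes "sorted_wrt (\<lambda>u v. w v \<le> w u) vs" and nonneg: "\<And>v. v \<in> set vs \<Longrightarrow> 0 \<le> w v"
  shows "ennreal (\<Sum>v\<leftarrow>vs. 2 * x v * w v - (w v)\<^sup>2) \<le> drift_area (map x vs)"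
proof -
  \<comment> \<open>Each term \<open>2 * x v * w v - (w v)\<^sup>2\<close> is the integral of
    \<open>2 * (x v - a)\<close> over the heights \<open>a\<close> from 0 to
    \<open>w v\<close>.\<close>
  define g where "g a = (\<Sum>v\<leftarrow>vs. (2 * (x v - a)) * indicator {0..w v} a)" for a
  have "has_bochner_integral lborel g (\<Sum>v\<leftarrow>vs. 2 * x v * w v - (w v)\<^sup>2)"
    unfolding g_def using nonneg
  proof (induction vs)
    case (Cons u vs)
    have "has_bochner_integral lborel (\<lambda>a. (2 * (x u - a)) * indicator {0..w u} a)
        ((2 * x u * w u - (w u)\<^sup>2) - (2 * x u * 0 - 0\<^sup>2))"
      by (rule has_bochner_integral_FTC_Icc_real)
         (use Cons.prems in \<open>auto intro!: derivative_eq_intros continuous_intros simp: algebra_simps\<close>)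
    with Cons show ?case
      by (auto intro!: has_bochner_integral_add)
  qed (simp add: has_bochner_integral_zero)
  then have int: "integrable lborel g" "integral\<^sup>L lborel g = (\<Sum>v\<leftarrow>vs. 2 * x v * w v - (w v)\<^sup>2)"
    by (auto simp: has_bochner_integral_iff)
  have le: "g a \<le> 2 * walk_max (map (\<lambda>x. x - a) (map x vs))" if "0 \<le> a" for a
  proof -
    have "g a = 2 * (\<Sum>v\<leftarrow>vs. if a \<le> w v then x v - a else 0)"
      unfolding g_def sum_list_const_mult[symmetric] using that
      by (intro arg_cong[of _ _ sum_list] map_cong) auto
    then show ?thesis
      using level_sum_le_walk_max[OF assms(1), of a x] by simp
  qed
  have zero: "g a = 0" if "a < 0" for a
  proof -
    have "g a = (\<Sum>v\<leftarrow>vs. 0)"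
      unfolding g_def using that by (intro arg_cong[of _ _ sum_list] map_cong) auto
    then show ?thesis by simp
  qed
  \<comment> \<open>Since \<open>g\<close> may be negative, its integral is first bounded by that of
    its positive part, which a nonnegative integral can express.\<close>
  have imax: "integrable lborel (\<lambda>a. max 0 (g a))"
    using int(1) by simp
  have "integral\<^sup>L lborel g \<le> integral\<^sup>L lborel (\<lambda>a. max 0 (g a))"
    using int(1) imax by (intro integral_mono) auto
  then have "ennreal (integral\<^sup>L lborel g) \<le> ennreal (integral\<^sup>L lborel (\<lambda>a. max 0 (g a)))"
    by (rule ennreal_leI)
  also have "\<dots> = (\<integral>\<^sup>+a. ennreal (max 0 (g a)) \<partial>lborel)"
    by (rule nn_integral_eq_integral[symmetric]) (use imax in auto)
  also have "\<dots> \<le> drift_area (map x vs)"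
    unfolding drift_area_def
  proof (rule nn_integral_mono)
    fix a :: real
    show "ennreal (max 0 (g a))
        \<le> ennreal (2 * walk_max (map (\<lambda>x. x - a) (map x vs))) * indicator {0..} a"
    proof (cases "0 \<le> a")
      case True
      then show ?thesis
        using le[OF True] walk_max_nonneg[of "map (\<lambda>x. x - a) (map x vs)"] by (auto intro!: ennreal_leI)
    qed (use zero in auto)
  qed
  finally show ?thesis using int(2) by simp
qed

text \<open>\<open>ennreal\<close> truncates negative reals to 0, and truncation is subadditive;
  signed quadratic terms can therefore be split before integrating.\<close>

lemma ennreal_add_le: "ennreal (a + b) \<le> ennreal a + ennreal b"
  by (cases "0 \<le> a"; cases "0 \<le> b") (auto simp: ennreal_plus[symmetric] ennreal_neg simp del: ennreal_plus intro!: ennreal_leI)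

lemma ennreal_sum_le: "ennreal (\<Sum>i\<in>S. f i) \<le> (\<Sum>i\<in>S. ennreal (f i))"
proof (induction S rule: infinite_finite_induct)
  case (insert i S)
  then show ?case
    using order_trans[OF ennreal_add_le add_left_mono] by simp
qed auto

text \<open>The positive part of \<open>w\<close> is nonincreasing along the list, the negative part
  along its reversal, where it meets the noise with opposite sign. At each vertex one of the two
  vanishes, so no cross term appears.\<close>

lemma signed_quadratic_le_drift_area:
  fixes x w :: "'i \<Rightarrow> real"
  assumes sorted: "sorted_wrt (\<lambda>u v. w v \<le> w u) vs"
  shows "ennreal (\<Sum>v\<leftarrow>vs. 2 * x v * w v - (w v)\<^sup>2)
    \<le> drift_area (map x vs) + drift_area (map (\<lambda>v. - x v) (rev vs))"
proof -
  let ?p = "\<lambda>v. max 0 (w v)" and ?m = "\<lambda>v. max 0 (- w v)"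
  have "(\<Sum>v\<leftarrow>vs. 2 * x v * w v - (w v)\<^sup>2)
      = (\<Sum>v\<leftarrow>vs. (2 * x v * ?p v - (?p v)\<^sup>2) + (2 * - x v * ?m v - (?m v)\<^sup>2))"
    by (intro arg_cong[of _ _ sum_list] map_cong) (auto simp: max_def power2_eq_square)
  also have "\<dots> = (\<Sum>v\<leftarrow>vs. 2 * x v * ?p v - (?p v)\<^sup>2) + (\<Sum>v\<leftarrow>rev vs. 2 * - x v * ?m v - (?m v)\<^sup>2)"
    by (simp add: sum_list_addf rev_map[symmetric])
  finally have "ennreal (\<Sum>v\<leftarrow>vs. 2 * x v * w v - (w v)\<^sup>2)
      \<le> ennreal (\<Sum>v\<leftarrow>vs. 2 * x v * ?p v - (?p v)\<^sup>2) + ennreal (\<Sum>v\<leftarrow>rev vs. 2 * - x v * ?m v - (?m v)\<^sup>2)"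
    using ennreal_add_le by simp
  also have "\<dots> \<le> drift_area (map x vs) + drift_area (map (\<lambda>v. - x v) (rev vs))"
    using sorted
    by (intro add_mono quadratic_le_drift_area)
       (auto simp: sorted_wrt_rev elim!: sorted_wrt_mono_rel[rotated])
  finally show ?thesis .
qed

section \<open>Gaussian noise\<close>

text \<open>Serves to pass from noise indexed by vertices to noise indexed by positions in a
  list.\<close>

lemma (in prob_space) indep_sets_reindex:
  assumes inj: "inj_on f I" and indep: "indep_sets F (f ` I)"
  shows "indep_sets (\<lambda>i. F (f i)) I"
proof (rule indep_setsI)
  fix A J assume J: "J \<noteq> {}" "J \<subseteq> I" "finite J" and A: "\<forall>j\<in>J. A j \<in> F (f j)"
  define B where "B k = A (the_inv_into J f k)" for k
  have injJ: "inj_on f J" using inj J(2) by (rule inj_on_subset)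
  have B: "B (f j) = A j" if "j \<in> J" for j
    unfolding B_def using the_inv_into_f_f[OF injJ that] by simp
  have "prob (\<Inter>k\<in>f ` J. B k) = (\<Prod>k\<in>f ` J. prob (B k))"
    by (rule indep_setsD[OF indep]) (use J A B in auto)
  then show "prob (\<Inter>j\<in>J. A j) = (\<Prod>j\<in>J. prob (A j))"
    using B by (simp add: prod.reindex[OF injJ])
qed (use indep in \<open>auto simp: indep_sets_def\<close>)

lemma (in prob_space) indep_vars_reindex:
  assumes "inj_on f I" "indep_vars M' X (f ` I)"
  shows "indep_vars (\<lambda>i. M' (f i)) (\<lambda>i. X (f i)) I"
  using assms by (auto simp: indep_vars_def2 intro: indep_sets_reindex)

lemma (in prob_space) nn_integral_square_normal:
  assumes "0 < s" and Y: "distributed M lborel Y (normal_density 0 s)"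
  shows "(\<integral>\<^sup>+\<omega>. ennreal ((Y \<omega>)\<^sup>2) \<partial>M) = ennreal (s\<^sup>2)"
proof -
  have "(\<integral>\<^sup>+\<omega>. ennreal ((Y \<omega>)\<^sup>2) \<partial>M) = (\<integral>\<^sup>+x. ennreal (normal_density 0 s x) * ennreal (x\<^sup>2) \<partial>lborel)"
    by (rule distributed_nn_integral[OF Y, symmetric]) simp
  also have "\<dots> = (\<integral>\<^sup>+x. ennreal (normal_density 0 s x * (x - 0) ^ (2 * 1)) \<partial>lborel)"
    by (simp add: ennreal_mult)
  also have "\<dots> = ennreal (s\<^sup>2)"
    using normal_moment_even[OF assms(1), of 0 1]
    by (subst nn_integral_eq_integral) (auto simp: has_bochner_integral_iff eval_nat_numeral)
  finally show ?thesis .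
qed

text \<open>By symmetry of the centred normal law the positive part carries half of the second moment.\<close>

lemma (in prob_space) nn_integral_pos_part_square_normal:
  assumes "0 < s" and Y: "distributed M lborel Y (normal_density 0 s)"
  shows "(\<integral>\<^sup>+\<omega>. ennreal ((max 0 (Y \<omega>))\<^sup>2) \<partial>M) = ennreal (s\<^sup>2 / 2)"
proof -
  have Y': "distributed M lborel (\<lambda>\<omega>. - Y \<omega>) (normal_density 0 s)"
    using normal_density_affine[OF Y assms(1), of "-1" 0] by simp
  have [measurable]: "Y \<in> borel_measurable M"
    using distributed_measurable[OF Y] by simp
  let ?E = "\<integral>\<^sup>+\<omega>. ennreal ((max 0 (Y \<omega>))\<^sup>2) \<partial>M"
  have "?E = (\<integral>\<^sup>+x. ennreal (normal_density 0 s x) * ennreal ((max 0 x)\<^sup>2) \<partial>lborel)"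
    by (rule distributed_nn_integral[OF Y, symmetric]) simp
  also have "\<dots> = (\<integral>\<^sup>+\<omega>. ennreal ((max 0 (- Y \<omega>))\<^sup>2) \<partial>M)"
    by (rule distributed_nn_integral[OF Y']) simp
  finally have "?E + ?E = (\<integral>\<^sup>+\<omega>. ennreal ((max 0 (Y \<omega>))\<^sup>2) + ennreal ((max 0 (- Y \<omega>))\<^sup>2) \<partial>M)"
    by (subst nn_integral_add) auto
  also have "\<dots> = (\<integral>\<^sup>+\<omega>. ennreal ((Y \<omega>)\<^sup>2) \<partial>M)"
    by (intro nn_integral_cong) (auto simp: max_def)
  also have "\<dots> = ennreal (s\<^sup>2)"
    using nn_integral_square_normal[OF assms] by simp
  finally have "2 * ?E = 2 * ennreal (s\<^sup>2 / 2)"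
    by (simp add: mult_2 flip: ennreal_plus)
  then show ?thesis
    by (subst (asm) ennreal_mult_cancel_left) simp
qed

locale gaussian_noise = prob_space M for M :: "'a measure" +
  fixes X :: "'i \<Rightarrow> 'a \<Rightarrow> real" and I :: "'i set" and \<sigma> :: real
  assumes \<sigma>_pos: "0 < \<sigma>"
    and indep: "indep_vars (\<lambda>_. borel) X I"
    and normal: "\<And>v. v \<in> I \<Longrightarrow> distributed M lborel (X v) (normal_density 0 \<sigma>)"
begin

lemma measurable_noise: "v \<in> I \<Longrightarrow> X v \<in> borel_measurable M"
  using distributed_measurable[OF normal] by simp

text \<open>The reversed lists of \<open>signed_quadratic_le_drift_area\<close> carry negated noise;
  by symmetry of the normal law the same expectations apply to it.\<close>

lemma gaussian_noise_uminus: "gaussian_noise M (\<lambda>v \<omega>. - X v \<omega>) I \<sigma>"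
proof
  show "indep_vars (\<lambda>_. borel) (\<lambda>v \<omega>. - X v \<omega>) I"
    by (rule indep_vars_compose2[OF indep]) auto
  show "distributed M lborel (\<lambda>\<omega>. - X v \<omega>) (normal_density 0 \<sigma>)" if "v \<in> I" for v
    using normal_density_affine[OF normal[OF that] \<sigma>_pos, of "-1" 0] by simp
qed (rule \<sigma>_pos)

text \<open>The joint law along a list is that of independent copies and depends on the length
  alone; this is the source of exchangeability.\<close>

lemma distr_noise_list:
  assumes "distinct vs" "set vs \<subseteq> I" "vs \<noteq> []"
  shows "distr M (PiM {..<length vs} (\<lambda>_. borel)) (\<lambda>\<omega>. \<lambda>i\<in>{..<length vs}. X (vs ! i) \<omega>)
    = PiM {..<length vs} (\<lambda>_. density lborel (normal_density 0 \<sigma>))"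
proof -
  have nth: "vs ! i \<in> I" if "i < length vs" for i
    using assms(2) that by (auto dest: nth_mem)
  have inj: "inj_on ((!) vs) {..<length vs}"
    using assms(1) by (auto simp: inj_on_def nth_eq_iff_index_eq)
  have "indep_vars (\<lambda>_. borel) X ((!) vs ` {..<length vs})"
    using nth by (intro indep_vars_subset[OF indep]) auto
  from indep_vars_reindex[OF inj this]
  have ind: "indep_vars (\<lambda>_. borel) (\<lambda>i. X (vs ! i)) {..<length vs}"
    by simp
  have "distr M (PiM {..<length vs} (\<lambda>_. borel)) (\<lambda>\<omega>. \<lambda>i\<in>{..<length vs}. X (vs ! i) \<omega>)
      = PiM {..<length vs} (\<lambda>i. distr M borel (X (vs ! i)))"
    by (rule indep_vars_iff_distr_eq_PiM'[THEN iffD1, OF _ _ ind])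
       (use assms(3) nth measurable_noise in auto)
  also have "\<dots> = PiM {..<length vs} (\<lambda>_. density lborel (normal_density 0 \<sigma>))"
  proof (rule PiM_cong[OF refl])
    fix i assume "i \<in> {..<length vs}"
    then have "distr M lborel (X (vs ! i)) = density lborel (normal_density 0 \<sigma>)"
      using normal nth by (intro distributed_distr_eq_density) auto
    \<comment> \<open>The normal law is given relative to \<open>lborel\<close>, whereas the product
      is formed over \<open>borel\<close>; the two share their measurable sets.\<close>
    moreover have "distr M borel (X (vs ! i)) = distr M lborel (X (vs ! i))"
      by (rule distr_cong) auto
    ultimately show "distr M borel (X (vs ! i)) = density lborel (normal_density 0 \<sigma>)"
      by simp
  qed
  finally show ?thesis .
qed

text \<open>Both sides integrate \<open>G\<close> against the same product law. Measurability of
  \<open>G\<close> is expressed through the coordinates of that finite product, so that no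
  sigma-algebra on lists is involved.\<close>

lemma nn_integral_noise_exchange:
  assumes vs: "distinct vs" "set vs \<subseteq> I" and ws: "distinct ws" "set ws \<subseteq> I"
    and len: "length vs = length ws"
    and G [measurable]: "(\<lambda>x. G (map x [0..<length ws])) \<in> borel_measurable (PiM {..<length ws} (\<lambda>_. borel))"
  shows "(\<integral>\<^sup>+\<omega>. G (map (\<lambda>v. X v \<omega>) vs) \<partial>M) = (\<integral>\<^sup>+\<omega>. G (map (\<lambda>v. X v \<omega>) ws) \<partial>M)"
proof (cases "ws = []")
  case True
  then show ?thesis using len by simp
next
  case False
  have law: "(\<integral>\<^sup>+\<omega>. G (map (\<lambda>v. X v \<omega>) us) \<partial>M)
      = (\<integral>\<^sup>+x. G (map x [0..<length ws]) \<partial>PiM {..<length ws} (\<lambda>_. density lborel (normal_density 0 \<sigma>)))"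
    if us: "distinct us" "set us \<subseteq> I" "length us = length ws" for us
  proof -
    have "X (us ! i) \<in> borel_measurable M" if "i < length us" for i
      using us(2) that by (intro measurable_noise) (auto dest: nth_mem)
    then have [measurable]: "(\<lambda>\<omega>. \<lambda>i\<in>{..<length ws}. X (us ! i) \<omega>) \<in> measurable M (PiM {..<length ws} (\<lambda>_. borel))"
      using us(3) by (intro measurable_restrict) auto
    have "map (\<lambda>v. X v \<omega>) us = map (\<lambda>i\<in>{..<length ws}. X (us ! i) \<omega>) [0..<length ws]" for \<omega>
      using us(3) by (intro nth_equalityI) auto
    then have "(\<integral>\<^sup>+\<omega>. G (map (\<lambda>v. X v \<omega>) us) \<partial>M)
        = (\<integral>\<^sup>+\<omega>. G (map (\<lambda>i\<in>{..<length ws}. X (us ! i) \<omega>) [0..<length ws]) \<partial>M)"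
      by simp
    also have "\<dots> = (\<integral>\<^sup>+x. G (map x [0..<length ws]) \<partial>distr M (PiM {..<length ws} (\<lambda>_. borel))
        (\<lambda>\<omega>. \<lambda>i\<in>{..<length ws}. X (us ! i) \<omega>))"
      by (subst nn_integral_distr) auto
    also have "distr M (PiM {..<length ws} (\<lambda>_. borel)) (\<lambda>\<omega>. \<lambda>i\<in>{..<length ws}. X (us ! i) \<omega>)
        = PiM {..<length ws} (\<lambda>_. density lborel (normal_density 0 \<sigma>))"
      using distr_noise_list[OF us(1,2)] us(3) False by fastforce
    finally show ?thesis .
  qed
  show ?thesis
    using law[OF vs len] law[OF ws refl] by simp
qed

lemma nn_integral_noise_square: "v \<in> I \<Longrightarrow> (\<integral>\<^sup>+\<omega>. ennreal ((X v \<omega>)\<^sup>2) \<partial>M) = ennreal (\<sigma>\<^sup>2)"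
  by (rule nn_integral_square_normal[OF \<sigma>_pos normal])

lemma gaussian_noise_sum:
  assumes "distinct vs" "set vs \<subseteq> I" "vs \<noteq> []"
  shows "distributed M lborel (\<lambda>\<omega>. \<Sum>v\<leftarrow>vs. X v \<omega>) (normal_density 0 (sqrt (real (length vs) * \<sigma>\<^sup>2)))"
proof -
  have "distributed M lborel (\<lambda>\<omega>. \<Sum>v\<in>set vs. X v \<omega>)
      (normal_density (\<Sum>v\<in>set vs. 0) (sqrt (\<Sum>v\<in>set vs. \<sigma>\<^sup>2)))"
    by (rule sum_indep_normal) (use assms normal \<sigma>_pos in \<open>auto intro: indep_vars_subset[OF indep]\<close>)
  then show ?thesis
    using assms(1) by (simp add: sum_list_distinct_conv_sum_set distinct_card)
qed

text \<open>All rotations have the same law, so expectations in \<open>drift_area_rotate\<close>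
  give r D_r = r D_(r-1) + \<sigma>^2 / 2, where D_r is the expectation at length r. The increments
  \<sigma>^2 / (2 r) add up to a harmonic number.\<close>

lemma nn_integral_drift_area:
  assumes "distinct vs" "set vs \<subseteq> I"
  shows "(\<integral>\<^sup>+\<omega>. drift_area (map (\<lambda>v. X v \<omega>) vs) \<partial>M) = ennreal (\<sigma>\<^sup>2 * harm (length vs) / 2)"
  using assms
proof (induction "length vs" arbitrary: vs)
  case 0
  then show ?case by (simp add: drift_area_def harm_def)
next
  case (Suc n)
  then have ne: "vs \<noteq> []" by auto
  let ?D = "\<lambda>vs \<omega>. drift_area (map (\<lambda>v. X v \<omega>) vs)"
  let ?S = "\<lambda>\<omega>. \<Sum>v\<leftarrow>vs. X v \<omega>"
  have [measurable]: "?D us \<in> borel_measurable M" if "set us \<subseteq> I" for us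
    using that measurable_noise by (intro borel_measurable_drift_area) auto
  have sub: "set (butlast (rotate c vs)) \<subseteq> I" for c
    using Suc.prems in_set_butlastD[of _ "rotate c vs"] by auto
  have mS [measurable]: "?S \<in> borel_measurable M"
    using distributed_measurable[OF gaussian_noise_sum[OF Suc.prems ne]] by simp
  have exch: "integral\<^sup>N M (?D (rotate c vs)) = integral\<^sup>N M (?D vs)" for c
    using Suc.prems by (intro nn_integral_noise_exchange borel_measurable_drift_area) auto
  have short: "integral\<^sup>N M (?D (butlast (rotate c vs))) = ennreal (\<sigma>\<^sup>2 * harm n / 2)" for c
    using Suc.hyps(1)[of "butlast (rotate c vs)"] Suc.prems sub[of c]
    by (simp add: distinct_butlast flip: Suc.hyps(2))
  \<comment> \<open>A sum of r noise terms has variance r \<sigma>^2, of which the positive part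
    carries half; dividing by r removes the length.\<close>
  have last: "(\<integral>\<^sup>+\<omega>. ennreal ((max 0 (?S \<omega>))\<^sup>2 / real (length vs)) \<partial>M) = ennreal (\<sigma>\<^sup>2 / 2)"
  proof -
    let ?k = "real (length vs)"
    have k: "0 < ?k" using ne by simp
    have "(\<integral>\<^sup>+\<omega>. ennreal ((max 0 (?S \<omega>))\<^sup>2 / ?k) \<partial>M)
        = (\<integral>\<^sup>+\<omega>. ennreal (1 / ?k) * ennreal ((max 0 (?S \<omega>))\<^sup>2) \<partial>M)"
      using k by (intro nn_integral_cong) (simp flip: ennreal_mult)
    also have "\<dots> = ennreal (1 / ?k) * (\<integral>\<^sup>+\<omega>. ennreal ((max 0 (?S \<omega>))\<^sup>2) \<partial>M)"
      by (rule nn_integral_cmult) measurable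
    also have "(\<integral>\<^sup>+\<omega>. ennreal ((max 0 (?S \<omega>))\<^sup>2) \<partial>M) = ennreal ((sqrt (?k * \<sigma>\<^sup>2))\<^sup>2 / 2)"
      using k \<sigma>_pos by (intro nn_integral_pos_part_square_normal gaussian_noise_sum Suc.prems ne) simp
    also have "ennreal (1 / ?k) * \<dots> = ennreal (\<sigma>\<^sup>2 / 2)"
      using k \<sigma>_pos by (simp flip: ennreal_mult)
    finally show ?thesis .
  qed
  have "of_nat (length vs) * integral\<^sup>N M (?D vs) = (\<Sum>c<length vs. integral\<^sup>N M (?D (rotate c vs)))"
    by (simp add: exch)
  also have "\<dots> = (\<integral>\<^sup>+\<omega>. (\<Sum>c<length vs. ?D (rotate c vs) \<omega>) \<partial>M)"
    using Suc.prems by (intro nn_integral_sum[symmetric]) auto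
  also have "\<dots> = (\<integral>\<^sup>+\<omega>. (\<Sum>c<length vs. ?D (butlast (rotate c vs)) \<omega>)
      + ennreal ((max 0 (?S \<omega>))\<^sup>2 / real (length vs)) \<partial>M)"
    using drift_area_rotate[of "map (\<lambda>v. X v _) vs"] ne
    by (intro nn_integral_cong) (simp add: rotate_map map_butlast)
  also have "\<dots> = (\<Sum>c<length vs. integral\<^sup>N M (?D (butlast (rotate c vs)))) + ennreal (\<sigma>\<^sup>2 / 2)"
    using sub by (simp add: nn_integral_add nn_integral_sum last)
  also have "\<dots> = of_nat (length vs) * ennreal (\<sigma>\<^sup>2 * harm n / 2) + ennreal (\<sigma>\<^sup>2 / 2)"
    by (simp add: short)
  also have "\<dots> = ennreal (real (length vs) * (\<sigma>\<^sup>2 * harm n / 2) + \<sigma>\<^sup>2 / 2)"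
    by (simp add: ennreal_of_nat_eq_real_of_nat harm_nonneg flip: ennreal_plus ennreal_mult)
  also have "real (length vs) * (\<sigma>\<^sup>2 * harm n / 2) + \<sigma>\<^sup>2 / 2 = real (length vs) * (\<sigma>\<^sup>2 * harm (length vs) / 2)"
    unfolding Suc.hyps(2)[symmetric] harm_Suc by (simp add: field_simps)
  also have "ennreal \<dots> = of_nat (length vs) * ennreal (\<sigma>\<^sup>2 * harm (length vs) / 2)"
    by (simp add: ennreal_of_nat_eq_real_of_nat harm_nonneg flip: ennreal_mult)
  finally show ?case
    using ne by (subst (asm) ennreal_mult_cancel_left) (auto simp: ennreal_of_nat_eq_real_of_nat)
qed

lemma nn_integral_drift_area_uminus:
  assumes "distinct vs" "set vs \<subseteq> I"
  shows "(\<integral>\<^sup>+\<omega>. drift_area (map (\<lambda>v. - X v \<omega>) vs) \<partial>M) = ennreal (\<sigma>\<^sup>2 * harm (length vs) / 2)"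
  by (rule gaussian_noise.nn_integral_drift_area[OF gaussian_noise_uminus assms])

end

section \<open>Flows and their least squares projection\<close>

lemma flowsD:
  assumes "\<theta> \<in> flows \<alpha> n" "j \<in> {1..num_paths \<alpha> n}" "1 \<le> i" "i \<le> k" "k \<le> path_length \<alpha> n"
  shows "\<theta> (Node j k) \<le> \<theta> (Node j i)" "0 \<le> \<theta> (Node j k)"
proof -
  let ?l = "path_length \<alpha> n"
  have step: "\<theta> (Node j (Suc i)) \<le> \<theta> (Node j i)" if "1 \<le> i" "i < ?l" for i
    using assms(1,2) that by (auto simp: flows_def)
  have anti: "\<theta> (Node j b) \<le> \<theta> (Node j a)" if "a \<le> b" "1 \<le> a" "b \<le> ?l" for a b
    using that by (induction b rule: dec_induct) (auto intro: order_trans[OF step])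
  show "\<theta> (Node j k) \<le> \<theta> (Node j i)"
    using anti assms by simp
  have "\<theta> (Node j ?l) \<le> \<theta> (Node j k)"
    using anti assms by simp
  moreover have "0 \<le> \<theta> (Node j ?l)"
    using assms(1,2) by (auto simp: flows_def)
  ultimately show "0 \<le> \<theta> (Node j k)" by simp
qed

lemma flows_Root:
  "\<theta> \<in> flows \<alpha> n \<Longrightarrow> (\<Sum>j = 1..num_paths \<alpha> n. \<theta> (Node j 1)) \<le> \<theta> Root"
  by (auto simp: flows_def)

lemma flows_outside: "\<theta> \<in> flows \<alpha> n \<Longrightarrow> v \<notin> tree_vertices \<alpha> n \<Longrightarrow> \<theta> v = 0"
  by (auto simp: flows_def)

lemma zero_in_flows: "(\<lambda>_. 0) \<in> flows \<alpha> n"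
  by (simp add: flows_def)

lemma flows_convex:
  assumes "\<theta> \<in> flows \<alpha> n" "\<nu> \<in> flows \<alpha> n" "0 \<le> t" "t \<le> 1"
  shows "(\<lambda>v. \<theta> v + t * (\<nu> v - \<theta> v)) \<in> flows \<alpha> n"
proof -
  have comb: "\<theta> v + t * (\<nu> v - \<theta> v) = (1 - t) * \<theta> v + t * \<nu> v" for v
    by (simp add: algebra_simps)
  have mono: "(1 - t) * a + t * b \<le> (1 - t) * c + t * d" if "a \<le> c" "b \<le> d" for a b c d
    using that assms(3,4) by (intro add_mono mult_left_mono) auto
  show ?thesis
    using assms unfolding flows_def comb
    by (auto simp: sum.distrib sum_distrib_left[symmetric] intro!: mono)
qed

section \<open>Existence and variational inequality of the projection\<close>

lemma closed_flows: "closed (flows \<alpha> n)"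
  unfolding flows_def Ball_def
  by (intro closed_Collect_conj closed_Collect_all closed_Collect_imp closed_Collect_le closed_Collect_eq
        open_Collect_const continuous_on_sum continuous_on_const continuous_on_product_coordinates)

lemma finite_tree_vertices: "finite (tree_vertices \<alpha> n)"
proof -
  have "{Node j i | j i. j \<in> {1..num_paths \<alpha> n} \<and> i \<in> {1..path_length \<alpha> n}}
      = case_prod Node ` ({1..num_paths \<alpha> n} \<times> {1..path_length \<alpha> n})"
    by auto
  then show ?thesis by (simp add: tree_vertices_def)
qed

lemma sum_tree_vertices:
  "(\<Sum>v\<in>tree_vertices \<alpha> n. f v)
    = f Root + (\<Sum>j = 1..num_paths \<alpha> n. \<Sum>i = 1..path_length \<alpha> n. f (Node j i))"
proof -
  let ?P = "{1..num_paths \<alpha> n} \<times> {1..path_length \<alpha> n}"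
  have T: "tree_vertices \<alpha> n = insert Root (case_prod Node ` ?P)"
    by (auto simp: tree_vertices_def)
  have "inj_on (case_prod Node) ?P"
    by (auto simp: inj_on_def)
  then have "(\<Sum>v\<in>case_prod Node ` ?P. f v) = (\<Sum>(j, i)\<in>?P. f (Node j i))"
    by (simp add: sum.reindex case_prod_unfold o_def)
  moreover have "Root \<notin> case_prod Node ` ?P" by auto
  ultimately show ?thesis
    by (simp add: T sum.cartesian_product)
qed

lemma tree_norm_square: "(tree_norm \<alpha> n x)\<^sup>2 = (\<Sum>v\<in>tree_vertices \<alpha> n. (x v)\<^sup>2)"
  by (simp add: tree_norm_def L2_set_def sum_nonneg)

lemma tree_norm_le_iff:
  "tree_norm \<alpha> n x \<le> tree_norm \<alpha> n y
    \<longleftrightarrow> (\<Sum>v\<in>tree_vertices \<alpha> n. (x v)\<^sup>2) \<le> (\<Sum>v\<in>tree_vertices \<alpha> n. (y v)\<^sup>2)"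
  by (simp add: tree_norm_def L2_set_def)

lemma abs_le_tree_norm: "v \<in> tree_vertices \<alpha> n \<Longrightarrow> \<bar>x v\<bar> \<le> tree_norm \<alpha> n x"
  unfolding tree_norm_def
  using member_le_L2_set[OF finite_tree_vertices, of v \<alpha> n "\<lambda>v. \<bar>x v\<bar>"]
  by (simp add: L2_set_def)

text \<open>Tychonoff's theorem; it is applied to the infinite type of vertices with the product
  topology on functions.\<close>

lemma compact_box: "compact {\<theta> :: 'i \<Rightarrow> real. \<forall>v. \<theta> v \<in> {a..b}}"
proof -
  have "compactin (product_topology (\<lambda>_. euclidean) UNIV) (PiE UNIV (\<lambda>_::'i. {a..b}))"
    by (simp add: compactin_PiE)
  moreover have "PiE UNIV (\<lambda>_::'i. {a..b}) = {\<theta>. \<forall>v. \<theta> v \<in> {a..b}}"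
    by auto
  ultimately show ?thesis
    by (simp add: euclidean_product_topology)
qed

lemma ex_flow_minimiser:
  "\<exists>\<theta>\<in>flows \<alpha> n. \<forall>\<nu>\<in>flows \<alpha> n. tree_norm \<alpha> n (\<lambda>v. y v - \<theta> v) \<le> tree_norm \<alpha> n (\<lambda>v. y v - \<nu> v)"
proof -
  let ?f = "\<lambda>\<theta>. tree_norm \<alpha> n (\<lambda>v. y v - \<theta> v)"
  \<comment> \<open>A coordinate larger than twice the norm of \<open>y\<close> is off from
    \<open>y v\<close> by more than that norm, which is the distance from \<open>y\<close> to the
    zero flow. Flows outside the box thus cannot beat zero.\<close>
  define B where "B = 2 * tree_norm \<alpha> n y"
  define K where "K = flows \<alpha> n \<inter> {\<theta>. \<forall>v. \<theta> v \<in> {-B..B}}"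
  have B: "0 \<le> B" by (simp add: B_def tree_norm_def)
  have "compact K"
    unfolding K_def by (intro closed_Int_compact closed_flows compact_box)
  moreover have "(\<lambda>_. 0) \<in> K"
    using B by (simp add: K_def zero_in_flows)
  moreover have "continuous_on K ?f"
    unfolding tree_norm_def L2_set_def
    by (intro continuous_intros continuous_on_product_then_coordinatewise[OF continuous_on_id])
  ultimately obtain \<theta> where \<theta>: "\<theta> \<in> K" and min: "\<And>\<nu>. \<nu> \<in> K \<Longrightarrow> ?f \<theta> \<le> ?f \<nu>"
    using continuous_attains_inf[of K ?f] by blast
  have "?f \<theta> \<le> ?f \<nu>" if \<nu>: "\<nu> \<in> flows \<alpha> n" for \<nu>
  proof (cases "\<nu> \<in> K")
    case False
    then obtain v where v: "\<not> \<bar>\<nu> v\<bar> \<le> B"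
      using \<nu> by (auto simp: K_def abs_le_iff) (metis minus_le_iff)+
    then have "v \<in> tree_vertices \<alpha> n"
      using flows_outside[OF \<nu>] B by fastforce
    then have "\<bar>y v - \<nu> v\<bar> \<le> ?f \<nu>" "\<bar>y v\<bar> \<le> tree_norm \<alpha> n y"
      using abs_le_tree_norm[of v \<alpha> n "\<lambda>v. y v - \<nu> v"] abs_le_tree_norm[of v \<alpha> n y] by auto
    moreover have "?f \<theta> \<le> tree_norm \<alpha> n y"
      using min[OF \<open>(\<lambda>_. 0) \<in> K\<close>] by simp
    ultimately show ?thesis
      using v unfolding B_def by linarith
  qed (rule min)
  then show ?thesis using \<theta> by (auto simp: K_def)
qed

lemma lse_minimal:
  "lse \<alpha> n y \<in> flows \<alpha> n"
  "\<nu> \<in> flows \<alpha> n \<Longrightarrow> tree_norm \<alpha> n (\<lambda>v. y v - lse \<alpha> n y v) \<le> tree_norm \<alpha> n (\<lambda>v. y v - \<nu> v)"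
proof -
  let ?f = "\<lambda>\<theta>. tree_norm \<alpha> n (\<lambda>v. y v - \<theta> v)"
  have "\<exists>\<theta>. is_arg_min ?f (\<lambda>\<theta>. \<theta> \<in> flows \<alpha> n) \<theta>"
    using ex_flow_minimiser[of \<alpha> n y] by (force simp: is_arg_min_def not_less)
  then have "is_arg_min ?f (\<lambda>\<theta>. \<theta> \<in> flows \<alpha> n) (lse \<alpha> n y)"
    unfolding lse_def arg_min_on_def arg_min_def by (rule someI_ex)
  then show "lse \<alpha> n y \<in> flows \<alpha> n"
    "\<nu> \<in> flows \<alpha> n \<Longrightarrow> ?f (lse \<alpha> n y) \<le> ?f \<nu>"
    by (auto simp: is_arg_min_def not_less)
qed

text \<open>First-order condition at a one-sided minimum: near 0 the linear term dominates.\<close>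

lemma nonneg_linear_coeff:
  fixes a b :: real
  assumes "\<And>t. 0 < t \<Longrightarrow> t \<le> 1 \<Longrightarrow> 0 \<le> a * t + b * t\<^sup>2"
  shows "0 \<le> a"
proof (rule ccontr)
  assume "\<not> 0 \<le> a"
  then have a: "a < 0" by simp
  \<comment> \<open>This choice keeps the quadratic term below half the size of the linear
    one.\<close>
  define t where "t = min 1 (- a / (2 * (\<bar>b\<bar> + 1)))"
  have t: "0 < t" "t \<le> 1" using a by (auto simp: t_def divide_neg_pos)
  have "t \<le> - a / (2 * (\<bar>b\<bar> + 1))" by (simp add: t_def)
  then have "t * (2 * (\<bar>b\<bar> + 1)) \<le> - a" by (subst (asm) pos_le_divide_eq) auto
  moreover have "b * t \<le> \<bar>b\<bar> * t" using t by (intro mult_right_mono) auto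
  moreover have "t * (2 * (\<bar>b\<bar> + 1)) = 2 * (\<bar>b\<bar> * t) + 2 * t" by (simp add: algebra_simps)
  ultimately have "a + b * t < 0" using t a by linarith
  then have "t * (a + b * t) < 0" using t(1) by (simp add: mult_pos_neg)
  then show False using assms[OF t] by (simp add: power2_eq_square algebra_simps)
qed

text \<open>The segment from \<open>\<theta>\<close> to \<open>\<nu>\<close> stays in the cone, so
  the squared distance to \<open>y\<close> cannot decrease at its start. The linear coefficient
  \<open>?a\<close> is therefore nonnegative and may be dropped from the expansion at
  \<open>t = 1\<close>.\<close>

lemma lse_pythagoras:
  fixes y :: "vertex \<Rightarrow> real"
  assumes \<nu>: "\<nu> \<in> flows \<alpha> n"
  defines "\<theta> \<equiv> lse \<alpha> n y"
  shows "(\<Sum>v\<in>tree_vertices \<alpha> n. (y v - \<theta> v)\<^sup>2) + (\<Sum>v\<in>tree_vertices \<alpha> n. (\<theta> v - \<nu> v)\<^sup>2)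
    \<le> (\<Sum>v\<in>tree_vertices \<alpha> n. (y v - \<nu> v)\<^sup>2)"
proof -
  let ?T = "tree_vertices \<alpha> n"
  let ?a = "- 2 * (\<Sum>v\<in>?T. (y v - \<theta> v) * (\<nu> v - \<theta> v))" and ?b = "\<Sum>v\<in>?T. (\<nu> v - \<theta> v)\<^sup>2"
  have expand: "(\<Sum>v\<in>?T. (y v - (\<theta> v + t * (\<nu> v - \<theta> v)))\<^sup>2)
      = (\<Sum>v\<in>?T. (y v - \<theta> v)\<^sup>2) + (?a * t + ?b * t\<^sup>2)" for t
    by (simp add: sum_distrib_left sum_distrib_right sum_negf[symmetric] sum.distrib[symmetric]
        power2_eq_square algebra_simps)
  have "0 \<le> ?a"
  proof (rule nonneg_linear_coeff)
    fix t :: real assume "0 < t" "t \<le> 1"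
    then have "(\<lambda>v. \<theta> v + t * (\<nu> v - \<theta> v)) \<in> flows \<alpha> n"
      unfolding \<theta>_def by (intro flows_convex lse_minimal(1) \<nu>) auto
    from lse_minimal(2)[OF this, of y] show "0 \<le> ?a * t + ?b * t\<^sup>2"
      using expand[of t] unfolding tree_norm_le_iff \<theta>_def by simp
  qed
  then show ?thesis
    using expand[of 1] by (simp add: power2_commute[of "\<theta> _"])
qed

lemma lse_oracle:
  fixes \<mu> e :: "vertex \<Rightarrow> real"
  assumes \<nu>: "\<nu> \<in> flows \<alpha> n"
  defines "\<theta> \<equiv> lse \<alpha> n (\<lambda>v. \<mu> v + e v)"
  shows "(tree_norm \<alpha> n (\<lambda>v. \<theta> v - \<mu> v))\<^sup>2
    \<le> (\<Sum>v\<in>tree_vertices \<alpha> n. (\<nu> v - \<mu> v)\<^sup>2)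
      + (\<Sum>v\<in>tree_vertices \<alpha> n. 2 * e v * (\<theta> v - \<nu> v) - (\<theta> v - \<nu> v)\<^sup>2)"
proof -
  let ?T = "tree_vertices \<alpha> n"
  \<comment> \<open>The last bracket is the slack of \<open>lse_pythagoras\<close> at the
    observation \<open>\<mu> + e\<close>, hence at most 0.\<close>
  have "(\<Sum>v\<in>?T. (\<theta> v - \<mu> v)\<^sup>2)
      = (\<Sum>v\<in>?T. (\<nu> v - \<mu> v)\<^sup>2) + (\<Sum>v\<in>?T. 2 * e v * (\<theta> v - \<nu> v) - (\<theta> v - \<nu> v)\<^sup>2)
        + ((\<Sum>v\<in>?T. (\<mu> v + e v - \<theta> v)\<^sup>2) + (\<Sum>v\<in>?T. (\<theta> v - \<nu> v)\<^sup>2) - (\<Sum>v\<in>?T. (\<mu> v + e v - \<nu> v)\<^sup>2))"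
    unfolding sum.distrib[symmetric] sum_subtractf[symmetric]
    by (intro sum.cong refl) (simp add: power2_eq_square algebra_simps)
  then show ?thesis
    using lse_pythagoras[OF \<nu>, of "\<lambda>v. \<mu> v + e v"] unfolding tree_norm_square \<theta>_def by linarith
qed

section \<open>Quadratic forms along the paths\<close>

definition path_vertices :: "nat \<Rightarrow> nat \<Rightarrow> vertex list" where
  "path_vertices l j = map (Node j) [1..<Suc l]"

lemma distinct_path_vertices: "distinct (path_vertices l j)"
  by (auto simp: path_vertices_def distinct_map inj_on_def)

lemma length_path_vertices [simp]: "length (path_vertices l j) = l"
  by (simp add: path_vertices_def)

lemma set_path_vertices: "set (path_vertices l j) = Node j ` {1..l}"
  by (auto simp: path_vertices_def)

lemma path_vertices_subset:
  "j \<in> {1..num_paths \<alpha> n} \<Longrightarrow> set (path_vertices (path_length \<alpha> n) j) \<subseteq> tree_vertices \<alpha> n"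
  by (auto simp: set_path_vertices tree_vertices_def)

lemma sum_list_path_vertices: "(\<Sum>v\<leftarrow>path_vertices l j. f v) = (\<Sum>i = 1..l. f (Node j i))"
  for f :: "vertex \<Rightarrow> real"
  unfolding path_vertices_def map_map o_def by (subst sum_list_distinct_conv_sum_set) (auto intro: sum.cong)

lemma sorted_path_vertices:
  assumes "\<theta> \<in> flows \<alpha> n" "j \<in> {1..num_paths \<alpha> n}"
  shows "sorted_wrt (\<lambda>u v. \<theta> v \<le> \<theta> u) (path_vertices (path_length \<alpha> n) j)"
  unfolding path_vertices_def sorted_wrt_map
  using flowsD(1)[OF assms] by (auto simp: sorted_wrt_iff_nth_less simp del: upt_Suc)

text \<open>The values at the first vertices are nonnegative and the root is at least their sum, so
  the root followed by the first path is still a nonincreasing list.\<close>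

lemma flow_quadratic_le:
  assumes w: "w \<in> flows \<alpha> n" and m: "1 \<le> num_paths \<alpha> n" and l: "1 \<le> path_length \<alpha> n"
  shows "ennreal (\<Sum>v\<in>tree_vertices \<alpha> n. 2 * e v * w v - (w v)\<^sup>2)
    \<le> drift_area (map e (Root # path_vertices (path_length \<alpha> n) 1))
      + (\<Sum>j = 2..num_paths \<alpha> n. drift_area (map e (path_vertices (path_length \<alpha> n) j)))"
proof -
  let ?l = "path_length \<alpha> n" and ?m = "num_paths \<alpha> n"
  let ?f = "\<lambda>v. 2 * e v * w v - (w v)\<^sup>2"
  have nonneg: "0 \<le> w v" if "v \<in> set (path_vertices ?l j)" "j \<in> {1..?m}" for v j
    using that flowsD(2)[OF w that(2)] by (auto simp: set_path_vertices)
  have first: "w v \<le> w Root" if "v \<in> set (path_vertices ?l 1)" for v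
  proof -
    have "w v \<le> w (Node 1 1)"
      using that flowsD(1)[OF w, of 1 1] m by (auto simp: set_path_vertices)
    also have "\<dots> \<le> (\<Sum>j = 1..?m. w (Node j 1))"
      using m l flowsD(2)[OF w, of _ 1 1] by (intro member_le_sum) auto
    also have "\<dots> \<le> w Root"
      by (rule flows_Root[OF w])
    finally show ?thesis .
  qed
  have split: "{1..?m} = insert 1 {2..?m}" using m by auto
  have "(\<Sum>v\<in>tree_vertices \<alpha> n. ?f v)
      = (\<Sum>v\<leftarrow>Root # path_vertices ?l 1. ?f v) + (\<Sum>j = 2..?m. \<Sum>v\<leftarrow>path_vertices ?l j. ?f v)"
    unfolding sum_tree_vertices split by (simp add: sum_list_path_vertices)
  then have "ennreal (\<Sum>v\<in>tree_vertices \<alpha> n. ?f v)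
      \<le> ennreal (\<Sum>v\<leftarrow>Root # path_vertices ?l 1. ?f v) + ennreal (\<Sum>j = 2..?m. \<Sum>v\<leftarrow>path_vertices ?l j. ?f v)"
    by (simp only: ennreal_add_le)
  also have "\<dots> \<le> ennreal (\<Sum>v\<leftarrow>Root # path_vertices ?l 1. ?f v) + (\<Sum>j = 2..?m. ennreal (\<Sum>v\<leftarrow>path_vertices ?l j. ?f v))"
    by (intro add_left_mono ennreal_sum_le)
  also have "\<dots> \<le> drift_area (map e (Root # path_vertices ?l 1)) + (\<Sum>j = 2..?m. drift_area (map e (path_vertices ?l j)))"
  proof (intro add_mono sum_mono quadratic_le_drift_area)
    show "sorted_wrt (\<lambda>u v. w v \<le> w u) (Root # path_vertices ?l 1)"
      using first sorted_path_vertices[OF w, of 1] m by simp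
    show "0 \<le> w v" if "v \<in> set (Root # path_vertices ?l 1)" for v
    proof -
      have "0 \<le> w (Node 1 1)" using m l flowsD(2)[OF w, of 1 1 1] by simp
      moreover have "Node 1 1 \<in> set (path_vertices ?l 1)" using l by (auto simp: set_path_vertices)
      ultimately show ?thesis using that first[of "Node 1 1"] nonneg[of v 1] m by auto
    qed
  qed (use sorted_path_vertices[OF w] nonneg in auto)
  finally show ?thesis .
qed

lemma sum_list_partition:
  fixes f :: "'i \<Rightarrow> real" and k :: "'i \<Rightarrow> nat"
  assumes "\<And>v. v \<in> set vs \<Longrightarrow> k v \<le> q"
  shows "(\<Sum>v\<leftarrow>vs. f v) = (\<Sum>p\<le>q. \<Sum>v\<leftarrow>filter (\<lambda>v. k v = p) vs. f v)"
  using assms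
proof (induction vs)
  case (Cons u vs)
  have "(\<Sum>p\<le>q. \<Sum>v\<leftarrow>filter (\<lambda>v. k v = p) (u # vs). f v)
      = (\<Sum>p\<le>q. (if p = k u then f u else 0) + (\<Sum>v\<leftarrow>filter (\<lambda>v. k v = p) vs. f v))"
    by (intro sum.cong) auto
  also have "\<dots> = f u + (\<Sum>v\<leftarrow>vs. f v)"
    using Cons by (simp add: sum.distrib)
  finally show ?case by simp
qed simp

text \<open>On each level set of the rounded flow \<open>g \<circ> k\<close> the deviation is monotone; on the zero level
  it is moreover nonnegative, which halves the cost.\<close>

lemma level_quadratic_le:
  fixes e \<theta> :: "'i \<Rightarrow> real" and k :: "'i \<Rightarrow> nat"
  assumes sorted: "sorted_wrt (\<lambda>u v. \<theta> v \<le> \<theta> u) vs"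
    and nonneg: "\<And>v. v \<in> set vs \<Longrightarrow> 0 \<le> \<theta> v"
    and k: "\<And>v. v \<in> set vs \<Longrightarrow> k v \<le> q" and g: "g 0 = 0"
  shows "ennreal (\<Sum>v\<leftarrow>vs. 2 * e v * (\<theta> v - g (k v)) - (\<theta> v - g (k v))\<^sup>2)
    \<le> (\<Sum>p\<le>q. drift_area (map e (filter (\<lambda>v. k v = p) vs)))
      + (\<Sum>p = 1..q. drift_area (map (\<lambda>v. - e v) (rev (filter (\<lambda>v. k v = p) vs))))"
proof -
  let ?f = "\<lambda>p v. 2 * e v * (\<theta> v - g p) - (\<theta> v - g p)\<^sup>2"
  let ?F = "\<lambda>p. filter (\<lambda>v. k v = p) vs"
  have sF: "sorted_wrt (\<lambda>u v. \<theta> v - g p \<le> \<theta> u - g p) (?F p)" for p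
    using sorted_wrt_filter[OF sorted] by simp
  have zero: "ennreal (\<Sum>v\<leftarrow>?F 0. ?f 0 v) \<le> drift_area (map e (?F 0))"
    by (rule quadratic_le_drift_area[OF sF]) (use g nonneg in auto)
  have pos: "ennreal (\<Sum>v\<leftarrow>?F p. ?f p v) \<le> drift_area (map e (?F p)) + drift_area (map (\<lambda>v. - e v) (rev (?F p)))" for p
    by (rule signed_quadratic_le_drift_area[OF sF])
  have split: "{..q} = insert 0 {1..q}" by auto
  have "(\<Sum>v\<leftarrow>vs. ?f (k v) v) = (\<Sum>p\<le>q. \<Sum>v\<leftarrow>?F p. ?f (k v) v)"
    by (rule sum_list_partition[OF k])
  also have "\<dots> = (\<Sum>p\<le>q. \<Sum>v\<leftarrow>?F p. ?f p v)"
    by (intro sum.cong refl arg_cong[of _ _ sum_list] map_cong) auto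
  finally have "ennreal (\<Sum>v\<leftarrow>vs. ?f (k v) v) \<le> (\<Sum>p\<le>q. ennreal (\<Sum>v\<leftarrow>?F p. ?f p v))"
    by (simp only: ennreal_sum_le)
  also have "\<dots> = ennreal (\<Sum>v\<leftarrow>?F 0. ?f 0 v) + (\<Sum>p = 1..q. ennreal (\<Sum>v\<leftarrow>?F p. ?f p v))"
    unfolding split by (subst sum.insert) auto
  also have "\<dots> \<le> drift_area (map e (?F 0))
      + (\<Sum>p = 1..q. drift_area (map e (?F p)) + drift_area (map (\<lambda>v. - e v) (rev (?F p))))"
    by (intro add_mono sum_mono zero pos)
  also have "\<dots> = (\<Sum>p\<le>q. drift_area (map e (?F p))) + (\<Sum>p = 1..q. drift_area (map (\<lambda>v. - e v) (rev (?F p))))"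
    unfolding split by (simp add: sum.distrib add.assoc)
  finally show ?thesis .
qed

section \<open>Rounding and elementary estimates\<close>

text \<open>For positive \<open>t\<close> and real \<open>q\<close> the left side is least at 2 q +
  1 = 4^(1/3) t, with value 3 / 2^(4/3) t - 1/2, and 3 / 2^(4/3) < 1.191. The constant 6/5 leaves
  room for integrality, and the slope 4/5 below approximates half of 4^(1/3).\<close>

lemma ex_rounding_level:
  fixes t :: real
  assumes "0 \<le> t"
  shows "\<exists>q::nat. t ^ 3 / (2 * real q + 1)\<^sup>2 + real q \<le> 6 / 5 * t"
proof (cases "t \<le> 1")
  case True
  have "t ^ 3 \<le> t ^ 1" using assms True by (intro power_decreasing) auto
  then show ?thesis using assms by (intro exI[of _ 0]) simp
next
  case t1: False
  show ?thesis
  proof (cases "t \<le> 5 / 4")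
    case True
    have "t * t\<^sup>2 \<le> t * (5 / 4)\<^sup>2"
      using t1 True by (intro mult_left_mono power_mono) auto
    then have "t ^ 3 \<le> 25 / 16 * t"
      by (simp add: power3_eq_cube power2_eq_square)
    then show ?thesis using t1 by (intro exI[of _ 1]) simp
  next
    case False
    define q where "q = nat \<lfloor>4 / 5 * t\<rfloor>"
    define r s where "r = real q" and "s = 4 / 5 * t - r"
    have r_floor: "r = of_int \<lfloor>4 / 5 * t\<rfloor>"
      using assms by (simp add: r_def q_def)
    then have s: "0 \<le> s" "s \<le> 1" unfolding s_def by linarith+
    have "1 \<le> \<lfloor>4 / 5 * t\<rfloor>" using False by (simp add: le_floor_iff)
    then have r: "1 \<le> r" using r_floor by simp
    have t: "t = 5 / 4 * (r + s)" by (simp add: s_def)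
    have "s\<^sup>2 \<le> s" "s ^ 3 \<le> s"
      using s power_decreasing[of 1 2 s] power_decreasing[of 1 3 s] by auto
    then have "r * s\<^sup>2 \<le> r * s" using r by (intro mult_left_mono) auto
    with \<open>s ^ 3 \<le> s\<close> have cube: "(r + s) ^ 3 \<le> r ^ 3 + 3 * (r\<^sup>2 * s) + 3 * (r * s) + s"
      by (simp add: power3_eq_cube power2_eq_square algebra_simps)
    have t3: "t ^ 3 = 125 / 64 * (r + s) ^ 3" unfolding t power_mult_distrib by (simp add: power3_eq_cube)
    have "1 \<le> r\<^sup>2" using r by simp
    have "0 \<le> r ^ 3" "0 \<le> r\<^sup>2 * s" "0 \<le> r * s" using r s by auto
    \<comment> \<open>The coefficients satisfy 125/64 < 2 and 375/64 < 6. Only the term in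
      \<open>s\<close> goes the wrong way, by less than 1/2, and \<open>2 * D\<close> absorbs
      it.\<close>
    moreover have "125 / 64 * (A + 3 * B + 3 * C + s) \<le> 2 * A + 2 * D + r / 2 + 6 * B + 6 * C + 3 / 2 * s"
      if "0 \<le> A" "0 \<le> B" "0 \<le> C" "1 \<le> D" for A B C D
      using that s r by argo
    ultimately have poly: "125 / 64 * (r ^ 3 + 3 * (r\<^sup>2 * s) + 3 * (r * s) + s)
        \<le> 2 * r ^ 3 + 2 * r\<^sup>2 + r / 2 + 6 * (r\<^sup>2 * s) + 6 * (r * s) + 3 / 2 * s"
      using \<open>1 \<le> r\<^sup>2\<close> by blast
    note t3
    also have "125 / 64 * (r + s) ^ 3 \<le> 125 / 64 * (r ^ 3 + 3 * (r\<^sup>2 * s) + 3 * (r * s) + s)"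
      by (rule mult_left_mono[OF cube]) simp
    also note poly
    also have "2 * r ^ 3 + 2 * r\<^sup>2 + r / 2 + 6 * (r\<^sup>2 * s) + 6 * (r * s) + 3 / 2 * s
        = (6 / 5 * t - r) * (2 * r + 1)\<^sup>2"
      by (simp add: t power3_eq_cube power2_eq_square algebra_simps)
    finally have "t ^ 3 \<le> (6 / 5 * t - r) * (2 * r + 1)\<^sup>2" .
    then have "t ^ 3 / (2 * r + 1)\<^sup>2 \<le> 6 / 5 * t - r"
      using r by (simp add: pos_divide_le_eq)
    then show ?thesis unfolding r_def by (intro exI[of _ q]) linarith
  qed
qed

text \<open>The arithmetic-geometric mean inequality for \<open>a\<close>, \<open>a\<close>,
  \<open>c\<close>; the gap between the cubes factors with a square.\<close>

lemma am_gm_cube: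
  fixes a c t :: real
  assumes "0 \<le> a" "0 \<le> c" "t ^ 3 = a\<^sup>2 * c"
  shows "3 * t \<le> 2 * a + c"
proof (rule ccontr)
  assume "\<not> ?thesis"
  then have "(2 * a + c) ^ 3 < (3 * t) ^ 3"
    using assms by (intro power_strict_mono) auto
  moreover have "(2 * a + c) ^ 3 = 27 * (a\<^sup>2 * c) + (a - c)\<^sup>2 * (8 * a + c)"
    by (simp add: power3_eq_cube power2_eq_square algebra_simps)
  moreover have "0 \<le> (a - c)\<^sup>2 * (8 * a + c)" using assms by simp
  ultimately show False using assms(3) by (simp add: power_mult_distrib)
qed

text \<open>Jensen's inequality for \<open>x \<mapsto> x powr (2 / 3)\<close>, stated through cubes.\<close>

lemma sum_cube_roots_le:
  fixes v t :: "'i \<Rightarrow> real"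
  assumes v: "\<And>j. j \<in> J \<Longrightarrow> 0 \<le> v j" "sum v J \<le> V" and V: "0 < V"
    and c: "0 \<le> c" and t: "\<And>j. j \<in> J \<Longrightarrow> t j ^ 3 = (v j)\<^sup>2 * c"
    and \<tau>: "0 < \<tau>" "\<tau> ^ 3 = V\<^sup>2 * (real (card J) * c)"
  shows "sum t J \<le> \<tau>"
proof -
  \<comment> \<open>The weights make both arguments equal when \<open>v j = V / card J\<close>, so
    this is the tangent line of the concave function at the uniform split.\<close>
  have "3 * t j \<le> 2 * (v j * (\<tau> / V)) + V\<^sup>2 / \<tau>\<^sup>2 * c" if "j \<in> J" for j
  proof (rule am_gm_cube)
    show "0 \<le> v j * (\<tau> / V)" using v(1)[OF that] V \<tau> by simp
    show "t j ^ 3 = (v j * (\<tau> / V))\<^sup>2 * (V\<^sup>2 / \<tau>\<^sup>2 * c)"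
      using t[OF that] V \<tau> by (simp add: field_simps)
  qed (use c in auto)
  then have "(\<Sum>j\<in>J. 3 * t j) \<le> (\<Sum>j\<in>J. 2 * (v j * (\<tau> / V)) + V\<^sup>2 / \<tau>\<^sup>2 * c)"
    by (rule sum_mono)
  also have "\<dots> = 2 * (sum v J * (\<tau> / V)) + V\<^sup>2 * (real (card J) * c) / \<tau>\<^sup>2"
    by (simp add: sum.distrib sum_distrib_left sum_distrib_right sum_divide_distrib)
  also have "V\<^sup>2 * (real (card J) * c) / \<tau>\<^sup>2 = \<tau> ^ 3 / \<tau>\<^sup>2"
    by (simp only: \<tau>(2))
  also have "\<dots> = \<tau>"
    using \<tau>(1) by (simp add: power3_eq_cube power2_eq_square)
  also have "sum v J * (\<tau> / V) \<le> V * (\<tau> / V)"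
    using v(2) V \<tau> by (intro mult_right_mono) auto
  finally show ?thesis using V by (simp flip: sum_distrib_left)
qed

text \<open>Rounding to the nearest multiple of \<open>2 * h\<close>, with ties going down. The tie
  rule matters at the top: \<open>(2 * q + 1) * h\<close> lies halfway between two multiples and
  must be sent to level \<open>q\<close>.\<close>

lemma rounding_error:
  fixes u h :: real
  assumes "0 \<le> u" "u \<le> (2 * real q + 1) * h" "0 \<le> h"
  defines "k \<equiv> nat \<lceil>u / (2 * h) - 1 / 2\<rceil>"
  shows "\<bar>2 * h * real k - u\<bar> \<le> h" "k \<le> q"
proof -
  show "\<bar>2 * h * real k - u\<bar> \<le> h"
  proof (cases "h = 0")
    case False
    then have h: "0 < h" using assms(3) by simp
    have "0 \<le> u / (2 * h)" using assms(1) h by simp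
    then have "-1 < u / (2 * h) - 1 / 2" by linarith
    \<comment> \<open>The argument may be as low as -1/2, but its ceiling is then 0, so
      \<open>nat\<close> loses nothing.\<close>
    then have "0 \<le> \<lceil>u / (2 * h) - 1 / 2\<rceil>" by (simp add: less_ceiling_iff[of "-1", simplified] flip: zle_iff_zadd)
    then have "real k = of_int \<lceil>u / (2 * h) - 1 / 2\<rceil>" by (simp add: k_def)
    then have "u / (2 * h) - 1 / 2 \<le> real k" "real k < u / (2 * h) + 1 / 2" by linarith+
    then have "2 * h * (u / (2 * h) - 1 / 2) \<le> 2 * h * real k" "2 * h * real k \<le> 2 * h * (u / (2 * h) + 1 / 2)"
      using h by (intro mult_left_mono; simp)+
    then show ?thesis using h by (simp add: algebra_simps abs_le_iff)
  qed (use assms in simp)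
  \<comment> \<open>For \<open>h = 0\<close> the quotient is 0 by the convention on division by
    zero.\<close>
  have "u / (2 * h) - 1 / 2 \<le> real q"
  proof (cases "h = 0")
    case False
    then show ?thesis using assms by (simp add: field_simps)
  qed simp
  then show "k \<le> q" by (simp add: k_def ceiling_le_iff)
qed

section \<open>Harmonic numbers, tree sizes and the arithmetic of the constants\<close>

lemma ln2_ge: "69 / 100 \<le> ln (2 :: real)"
  using ln_approx_bounds[of 2 2] by (simp add: eval_nat_numeral)

text \<open>The difference of harmonic number and logarithm decreases; it starts at 1.\<close>

lemma harm_le_ln: "1 \<le> l \<Longrightarrow> harm l \<le> 1 + ln (real l)"
  using euler_mascheroni_sequence_decreasing[of 1 l] by (simp add: harm_def)

text \<open>The same difference at index 2 is 3/2 - ln 2.\<close>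

lemma harm_le_ln': "2 \<le> l \<Longrightarrow> harm l \<le> 81 / 100 + ln (real l)"
  using euler_mascheroni_sequence_decreasing[of 2 l] ln2_ge by (simp add: harm_expand)

lemma tree_dimensions:
  fixes \<alpha> :: real and n :: nat
  assumes "0 \<le> \<alpha>" "\<alpha> \<le> 1" "1 \<le> n"
  defines "m \<equiv> num_paths \<alpha> n" and "l \<equiv> path_length \<alpha> n"
  shows "1 \<le> m" "1 \<le> l" "m \<le> n" "l \<le> n" "m * l \<le> 2 * n" "real m < real n powr \<alpha> + 1" "1 \<le> real n powr \<alpha>"
proof -
  let ?a = "real n powr \<alpha>" and ?b = "real n powr (1 - \<alpha>)"
  have ab: "?a * ?b = real n" using assms(3) by (simp flip: powr_add)
  have ge: "1 \<le> ?a" "1 \<le> ?b"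
    using assms ge_one_powr_ge_zero[of "real n"] by auto
  then show "1 \<le> ?a" by simp
  have le: "?a \<le> real n" "?b \<le> real n"
    using assms powr_mono[of \<alpha> 1 "real n"] powr_mono[of "1 - \<alpha>" 1 "real n"] by auto
  have m: "real m = of_int \<lceil>?a\<rceil>" and l: "real l = of_int \<lceil>?b\<rceil>"
    using ge by (auto simp: m_def l_def num_paths_def path_length_def)
  show m1: "real m < ?a + 1" using m by linarith
  have l1: "real l < ?b + 1" using l by linarith
  have "1 \<le> real m" "1 \<le> real l" using m l ge by linarith+
  then show gm: "1 \<le> m" and gl: "1 \<le> l" by auto
  have "real m < real n + 1" "real l < real n + 1" using m1 l1 le by linarith+
  then show mn: "m \<le> n" and ln: "l \<le> n" by linarith+
  show "m * l \<le> 2 * n"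
  proof -
    \<comment> \<open>With \<open>k = m - 1\<close> and \<open>p = l - 1\<close> below the two
      powers, \<open>k * p \<le> n - 1\<close>. If both are positive then
      \<open>k + p \<le> k * p + 1\<close>, so the product is at most
      \<open>2 * k * p + 2 \<le> 2 * n\<close>; otherwise it is \<open>m\<close> or
      \<open>l\<close>.\<close>
    obtain k p where k: "m = Suc k" and p: "l = Suc p"
      using gm gl by (metis Suc_le_D One_nat_def)
    show ?thesis
    proof (cases "k = 0 \<or> p = 0")
      case True
      then show ?thesis using mn ln k p by auto
    next
      case False
      have "real k * real p < ?a * ?b"
        using False m1 l1 k p assms(3) by (intro mult_strict_mono) auto
      then have "k * p < n" unfolding ab by (metis of_nat_less_iff of_nat_mult)
      moreover have "k + p \<le> k * p + 1"
        using False by (cases k; cases p) auto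
      ultimately show ?thesis by (simp add: k p algebra_simps)
    qed
  qed
qed

text \<open>The noise cost of the zero competitor in units of \<sigma>^2. As only
  \<open>a > m - 1\<close> and \<open>a \<ge> 1\<close> are at hand, \<open>m = 2\<close> is the
  tight case and calls for the sharper harmonic bound.\<close>

lemma zero_fit_cost:
  fixes a :: real
  assumes "1 \<le> m" "1 \<le> l" "m \<le> n" "l \<le> n" "real m < a + 1" "1 \<le> a"
  shows "(harm (Suc l) + (real m - 1) * harm l) / 2 \<le> a * (1 + ln (real n))"
proof -
  define L where "L = 1 + ln (real n)"
  have L: "1 \<le> L" using assms by (simp add: L_def)
  have lnl: "ln (real l) \<le> ln (real n)" using assms by simp
  then have H: "harm l \<le> L" using harm_le_ln[OF assms(2)] unfolding L_def by linarith
  \<comment> \<open>Prepending the root to the first path costs just one more harmonic term.\<close>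
  have eq: "(harm (Suc l) + (real m - 1) * harm l) / 2 = real m * harm l / 2 + 1 / (2 * (real l + 1))"
    by (simp add: harm_Suc field_simps)
  have small: "1 / (2 * (real l + 1)) \<le> 1 / 4" using assms(2) by (simp add: field_simps)
  consider "m = 1" | "m = 2" | "3 \<le> m" using assms(1) by linarith
  then show ?thesis
  proof cases
    case 1
    have "1 * L \<le> a * L" using assms L by (intro mult_right_mono) auto
    moreover have "real m * harm l / 2 = harm l / 2" using 1 by simp
    ultimately show ?thesis unfolding eq L_def[symmetric] using H small L by linarith
  next
    case 2
    have "1 * L \<le> a * L" using assms L by (intro mult_right_mono) auto
    moreover have "harm l + 1 / (2 * (real l + 1)) \<le> L"
    proof (cases "l = 1")
      case True
      have "ln 2 \<le> ln (real n)" using 2 assms by simp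
      then show ?thesis using ln2_ge True by (simp add: harm_def L_def)
    next
      case False
      then have "2 \<le> l" using assms by simp
      moreover from this have "1 / (2 * (real l + 1)) \<le> 1 / 6" by (simp add: field_simps)
      ultimately show ?thesis using harm_le_ln'[of l] lnl unfolding L_def by linarith
    qed
    ultimately show ?thesis unfolding eq L_def[symmetric] using 2 by simp
  next
    case 3
    have "(real m - 1) * L \<le> a * L" using assms L by (intro mult_right_mono) auto
    moreover have "real m * harm l / 2 \<le> real m * L / 2" using H by (simp add: mult_left_mono)
    moreover have "1 / 4 \<le> (real m / 2 - 1) * L"
      using mult_mono[of "1 / 4" "real m / 2 - 1" 1 L] 3 L by simp
    ultimately have "real m * harm l / 2 + 1 / (2 * (real l + 1)) \<le> a * L"
      unfolding left_diff_distrib using small by linarith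
    then show ?thesis unfolding eq L_def .
  qed
qed

text \<open>The left side collects rounding, the free root (the summand 1) and half a harmonic
  number per path. The gap between \<open>2 * \<tau>\<close> and
  \<open>6 / 5 * \<tau>\<^sub>0\<close> has to pay for the root, which is where
  \<open>1 \<le> \<tau>\<close> enters.\<close>

lemma rounded_fit_cost:
  fixes a \<tau> \<tau>\<^sub>0 :: real
  assumes "1 \<le> m" "1 \<le> l" "m \<le> n" "l \<le> n" "real m < a + 1" "1 \<le> a"
    and \<tau>: "1 \<le> \<tau>" and \<tau>\<^sub>0: "\<tau>\<^sub>0 ^ 3 = \<tau> ^ 3 * (real (m * l) / real n)" and ml: "m * l \<le> 2 * n"
  shows "6 / 5 * \<tau>\<^sub>0 * (1 + ln (real n)) + 1 + real m * harm l / 2 \<le> (2 * \<tau> + a) * (1 + ln (real n))"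
proof -
  define L where "L = 1 + ln (real n)"
  have L: "1 \<le> L" using assms by (simp add: L_def)
  have n: "0 < real n" using assms by simp
  have lnl: "ln (real l) \<le> ln (real n)" using assms by simp
  then have H: "harm l \<le> L" using harm_le_ln[OF assms(2)] unfolding L_def by linarith
  have \<tau>L: "L \<le> \<tau> * L" using L \<tau> by simp
  show ?thesis
  proof (cases "m = 1")
    case True
    have "real (m * l) / real n \<le> 1" using True assms n by simp
    then have "\<tau>\<^sub>0 ^ 3 \<le> \<tau> ^ 3 * 1"
      unfolding \<tau>\<^sub>0 using \<tau> by (intro mult_left_mono) auto
    then have "\<tau>\<^sub>0 \<le> \<tau>" using \<tau> power_le_imp_le_base[of \<tau>\<^sub>0 2 \<tau>] by simp
    then have "6 / 5 * \<tau>\<^sub>0 * L \<le> 6 / 5 * \<tau> * L" using L by (intro mult_right_mono) auto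
    moreover have "1 * L \<le> a * L" using assms L by (intro mult_right_mono) auto
    moreover have "real m * harm l / 2 = harm l / 2" using True by simp
    ultimately show ?thesis unfolding L_def[symmetric] distrib_right using H \<tau>L L by linarith
  next
    case False
    then have m: "2 \<le> m" using assms by simp
    have "ln 2 \<le> ln (real n)" using m assms(3) by simp
    then have L': "169 / 100 \<le> L" unfolding L_def using ln2_ge by linarith
    have "real (m * l) / real n \<le> 2" using ml n by (simp add: pos_divide_le_eq del: of_nat_mult)
    \<comment> \<open>A rational upper bound for the cube root of 2, the largest possible ratio of
      \<open>\<tau>\<^sub>0\<close> to \<open>\<tau>\<close>.\<close>
    also have "2 \<le> (63 / 50 :: real) ^ 3" by (simp add: power3_eq_cube)
    finally have "\<tau>\<^sub>0 ^ 3 \<le> \<tau> ^ 3 * (63 / 50) ^ 3"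
      unfolding \<tau>\<^sub>0 using \<tau> by (intro mult_left_mono) auto
    then have "\<tau>\<^sub>0 ^ 3 \<le> (\<tau> * (63 / 50)) ^ 3" by (simp only: power_mult_distrib)
    then have "\<tau>\<^sub>0 \<le> \<tau> * (63 / 50)"
      using \<tau> power_le_imp_le_base[of \<tau>\<^sub>0 2 "\<tau> * (63 / 50)"] by simp
    then have 1: "6 / 5 * \<tau>\<^sub>0 * L \<le> 6 / 5 * (\<tau> * (63 / 50)) * L" using L by (intro mult_right_mono) auto
    have a: "(real m - 1) * L \<le> a * L" using assms L by (intro mult_right_mono) auto
    \<comment> \<open>The number 488/1000 is what remains of 2 after 6/5 * 63/50.\<close>
    have "1 + real m * harm l / 2 \<le> 488 / 1000 * L + (real m - 1) * L"
    proof (cases "m = 2")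
      case True
      show ?thesis
      proof (cases "l = 1")
        case True
        with \<open>m = 2\<close> L' show ?thesis by (simp add: harm_def)
      next
        case False
        then have "harm l \<le> 81 / 100 + ln (real n)" using harm_le_ln'[of l] assms lnl by linarith
        then have "1 + harm l \<le> 488 / 1000 * L + L" using L' unfolding L_def by argo
        with \<open>m = 2\<close> show ?thesis by simp
      qed
    next
      case False
      have "real m * harm l / 2 \<le> real m * L / 2" using H by (simp add: mult_left_mono)
      moreover have "(3 / 2 - 512 / 1000) * (169 / 100) \<le> (real m / 2 - 512 / 1000) * L"
        using False m L' by (intro mult_mono) auto
      ultimately show ?thesis by (simp add: algebra_simps)
    qed
    with 1 a \<tau>L show ?thesis unfolding L_def[symmetric] distrib_right by linarith
  qed
qed

section \<open>Risk bounds\<close>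

context gaussian_noise
begin

lemma borel_measurable_drift_area_noise:
  "set vs \<subseteq> I \<Longrightarrow> (\<lambda>\<omega>. drift_area (map (\<lambda>v. X v \<omega>) vs)) \<in> borel_measurable M"
  "set vs \<subseteq> I \<Longrightarrow> (\<lambda>\<omega>. drift_area (map (\<lambda>v. - X v \<omega>) vs)) \<in> borel_measurable M"
  using measurable_noise by (intro borel_measurable_drift_area borel_measurable_uminus; blast)+

text \<open>There are \<open>q + 1\<close> forward and \<open>q\<close> backward blocks, each
  bounded by the cost of the whole path. The labelling \<open>k\<close> is deterministic, so the
  blocks are fixed lists.\<close>

lemma nn_integral_levels_le:
  assumes vs: "distinct vs" "set vs \<subseteq> I"
  shows "(\<integral>\<^sup>+\<omega>. (\<Sum>p\<le>q. drift_area (map (\<lambda>v. X v \<omega>) (filter (\<lambda>v. k v = p) vs)))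
      + (\<Sum>p = 1..q. drift_area (map (\<lambda>v. - X v \<omega>) (rev (filter (\<lambda>v. k v = p) vs)))) \<partial>M)
    \<le> ennreal (\<sigma>\<^sup>2 * harm (length vs) * (real q + 1 / 2))"
proof -
  let ?F = "\<lambda>p. filter (\<lambda>v. k v = p) vs"
  let ?h = "\<sigma>\<^sup>2 * harm (length vs) / 2"
  have F: "distinct (?F p)" "set (?F p) \<subseteq> I" "distinct (rev (?F p))" "set (rev (?F p)) \<subseteq> I" for p
    using vs by auto
  have h: "\<sigma>\<^sup>2 * harm (length (?F p)) / 2 \<le> ?h" for p
    by (intro divide_right_mono mult_left_mono harm_mono) auto
  have m: "(\<lambda>\<omega>. drift_area (map (\<lambda>v. X v \<omega>) (?F p))) \<in> borel_measurable M"
    "(\<lambda>\<omega>. drift_area (map (\<lambda>v. - X v \<omega>) (rev (?F p)))) \<in> borel_measurable M" for p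
    by (intro borel_measurable_drift_area_noise F)+
  have "(\<integral>\<^sup>+\<omega>. (\<Sum>p\<le>q. drift_area (map (\<lambda>v. X v \<omega>) (?F p)))
      + (\<Sum>p = 1..q. drift_area (map (\<lambda>v. - X v \<omega>) (rev (?F p)))) \<partial>M)
      = (\<Sum>p\<le>q. \<integral>\<^sup>+\<omega>. drift_area (map (\<lambda>v. X v \<omega>) (?F p)) \<partial>M)
      + (\<Sum>p = 1..q. \<integral>\<^sup>+\<omega>. drift_area (map (\<lambda>v. - X v \<omega>) (rev (?F p))) \<partial>M)"
    using m by (subst nn_integral_add) (auto simp: nn_integral_sum )
  also have "\<dots> = (\<Sum>p\<le>q. ennreal (\<sigma>\<^sup>2 * harm (length (?F p)) / 2))
      + (\<Sum>p = 1..q. ennreal (\<sigma>\<^sup>2 * harm (length (?F p)) / 2))"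
    using nn_integral_drift_area[OF F(1,2)] nn_integral_drift_area_uminus[OF F(3,4)] by simp
  also have "\<dots> \<le> (\<Sum>p\<le>q. ennreal ?h) + (\<Sum>p = 1..q. ennreal ?h)"
    by (intro add_mono sum_mono ennreal_leI h)
  also have "\<dots> = ennreal (\<Sum>p\<le>q. ?h) + ennreal (\<Sum>p = 1..q. ?h)"
    by (simp only: sum_ennreal harm_nonneg zero_le_power2 mult_nonneg_nonneg divide_nonneg_nonneg zero_le_numeral)
  also have "\<dots> = ennreal (real (q + 1) * ?h + real q * ?h)"
    by (subst ennreal_plus) (auto simp: harm_nonneg)
  also have "real (q + 1) * ?h + real q * ?h = \<sigma>\<^sup>2 * harm (length vs) * (real q + 1 / 2)"
    by (simp add: field_simps)
  finally show ?thesis .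
qed

end

section \<open>Risk against the zero flow and against a rounded flow\<close>

locale tree_noise = gaussian_noise M X "tree_vertices \<alpha> n" \<sigma>
  for M :: "'a measure" and X \<alpha> n \<sigma>
begin

lemma risk_zero_fit:
  assumes m: "1 \<le> num_paths \<alpha> n" and l: "1 \<le> path_length \<alpha> n"
  shows "(\<integral>\<^sup>+\<omega>. ennreal ((tree_norm \<alpha> n (\<lambda>v. lse \<alpha> n (\<lambda>u. \<mu> u + X u \<omega>) v - \<mu> v))\<^sup>2) \<partial>M)
    \<le> ennreal ((\<Sum>v\<in>tree_vertices \<alpha> n. (\<mu> v)\<^sup>2)
        + \<sigma>\<^sup>2 * ((harm (Suc (path_length \<alpha> n)) + (real (num_paths \<alpha> n) - 1) * harm (path_length \<alpha> n)) / 2))"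
proof -
  let ?l = "path_length \<alpha> n" and ?m = "num_paths \<alpha> n" and ?T = "tree_vertices \<alpha> n"
  let ?D = "\<lambda>\<omega> vs. drift_area (map (\<lambda>v. X v \<omega>) vs)"
  let ?P = "path_vertices ?l" and ?R = "Root # path_vertices ?l 1"
  have P: "distinct (?P j)" "set (?P j) \<subseteq> ?T" if "j \<in> {2..?m}" for j
    using that distinct_path_vertices path_vertices_subset by auto
  have R: "distinct ?R" "set ?R \<subseteq> ?T"
    using distinct_path_vertices path_vertices_subset[of 1 \<alpha> n] m
    by (auto simp: set_path_vertices tree_vertices_def)
  have [measurable]: "(\<lambda>\<omega>. ?D \<omega> ?R) \<in> borel_measurable M"
    using R by (intro borel_measurable_drift_area_noise)
  have [measurable]: "(\<lambda>\<omega>. \<Sum>j = 2..?m. ?D \<omega> (?P j)) \<in> borel_measurable M"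
    using P by (intro borel_measurable_sum borel_measurable_drift_area_noise) auto
  have card: "real (card {2..?m}) = real ?m - 1" using m by (simp add: of_nat_diff)
  \<comment> \<open>The loss is dominated pointwise by a measurable function, so measurability of
    the estimator never enters.\<close>
  have "(\<integral>\<^sup>+\<omega>. ennreal ((tree_norm \<alpha> n (\<lambda>v. lse \<alpha> n (\<lambda>u. \<mu> u + X u \<omega>) v - \<mu> v))\<^sup>2) \<partial>M)
      \<le> (\<integral>\<^sup>+\<omega>. ennreal (\<Sum>v\<in>?T. (\<mu> v)\<^sup>2) + (?D \<omega> ?R + (\<Sum>j = 2..?m. ?D \<omega> (?P j))) \<partial>M)"
  proof (rule nn_integral_mono)
    fix \<omega>
    let ?w = "lse \<alpha> n (\<lambda>u. \<mu> u + X u \<omega>)"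
    have "ennreal ((tree_norm \<alpha> n (\<lambda>v. ?w v - \<mu> v))\<^sup>2)
        \<le> ennreal ((\<Sum>v\<in>?T. (\<mu> v)\<^sup>2) + (\<Sum>v\<in>?T. 2 * X v \<omega> * ?w v - (?w v)\<^sup>2))"
      using lse_oracle[OF zero_in_flows, of \<alpha> n \<mu> "\<lambda>u. X u \<omega>"] by (intro ennreal_leI) simp
    also have "\<dots> \<le> ennreal (\<Sum>v\<in>?T. (\<mu> v)\<^sup>2) + ennreal (\<Sum>v\<in>?T. 2 * X v \<omega> * ?w v - (?w v)\<^sup>2)"
      by (rule ennreal_add_le)
    also have "\<dots> \<le> ennreal (\<Sum>v\<in>?T. (\<mu> v)\<^sup>2) + (?D \<omega> ?R + (\<Sum>j = 2..?m. ?D \<omega> (?P j)))"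
      by (intro add_left_mono flow_quadratic_le lse_minimal m l)
    finally show "ennreal ((tree_norm \<alpha> n (\<lambda>v. ?w v - \<mu> v))\<^sup>2) \<le> \<dots>" .
  qed
  also have "\<dots> = ennreal (\<Sum>v\<in>?T. (\<mu> v)\<^sup>2)
      + ((\<integral>\<^sup>+\<omega>. ?D \<omega> ?R \<partial>M) + (\<Sum>j = 2..?m. \<integral>\<^sup>+\<omega>. ?D \<omega> (?P j) \<partial>M))"
  proof -
    have "(\<integral>\<^sup>+\<omega>. (\<Sum>j = 2..?m. ?D \<omega> (?P j)) \<partial>M) = (\<Sum>j = 2..?m. \<integral>\<^sup>+\<omega>. ?D \<omega> (?P j) \<partial>M)"
      using P by (intro nn_integral_sum borel_measurable_drift_area_noise)
    then show ?thesis
      by (subst nn_integral_add, simp, measurable, subst nn_integral_add, measurable)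
         (simp add: emeasure_space_1)
  qed
  also have "(\<integral>\<^sup>+\<omega>. ?D \<omega> ?R \<partial>M) = ennreal (\<sigma>\<^sup>2 * harm (Suc ?l) / 2)"
    using nn_integral_drift_area[OF R] by simp
  also have "(\<Sum>j = 2..?m. \<integral>\<^sup>+\<omega>. ?D \<omega> (?P j) \<partial>M) = (\<Sum>j = 2..?m. ennreal (\<sigma>\<^sup>2 * harm ?l / 2))"
    using nn_integral_drift_area P by (intro sum.cong) auto
  also have "\<dots> = ennreal (\<Sum>j = 2..?m. \<sigma>\<^sup>2 * harm ?l / 2)"
    by (rule sum_ennreal) (simp add: harm_nonneg)
  also have "\<dots> = ennreal ((real ?m - 1) * (\<sigma>\<^sup>2 * harm ?l / 2))"
    by (simp only: sum_constant card)
  also have "ennreal (\<Sum>v\<in>?T. (\<mu> v)\<^sup>2) + (ennreal (\<sigma>\<^sup>2 * harm (Suc ?l) / 2) + \<dots>)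
      = ennreal ((\<Sum>v\<in>?T. (\<mu> v)\<^sup>2) + (\<sigma>\<^sup>2 * harm (Suc ?l) / 2 + (real ?m - 1) * (\<sigma>\<^sup>2 * harm ?l / 2)))"
    using m by (simp add: harm_nonneg sum_nonneg ennreal_plus)
  finally show ?thesis
    by (simp add: algebra_simps add_divide_distrib diff_divide_distrib)
qed

text \<open>The competitor takes the levels 0, 2 h, ..., 2 q h on each path; the relation between
  \<open>q\<close> and \<open>h\<close> makes \<open>h\<close> the rounding error even at the top.
  The root keeps its true value.\<close>

lemma risk_rounded_fit:
  fixes q :: "nat \<Rightarrow> nat" and h :: "nat \<Rightarrow> real"
  assumes \<mu>: "\<mu> \<in> flows \<alpha> n" and l: "1 \<le> path_length \<alpha> n"
    and h: "\<And>j. j \<in> {1..num_paths \<alpha> n} \<Longrightarrow> 0 \<le> h j"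
    and q: "\<And>j. j \<in> {1..num_paths \<alpha> n} \<Longrightarrow> \<mu> (Node j 1) = (2 * real (q j) + 1) * h j"
  shows "(\<integral>\<^sup>+\<omega>. ennreal ((tree_norm \<alpha> n (\<lambda>v. lse \<alpha> n (\<lambda>u. \<mu> u + X u \<omega>) v - \<mu> v))\<^sup>2) \<partial>M)
    \<le> ennreal ((\<Sum>j = 1..num_paths \<alpha> n. real (path_length \<alpha> n) * (h j)\<^sup>2)
        + (\<sigma>\<^sup>2 + (\<Sum>j = 1..num_paths \<alpha> n. \<sigma>\<^sup>2 * harm (path_length \<alpha> n) * (real (q j) + 1 / 2))))"
proof -
  let ?l = "path_length \<alpha> n" and ?m = "num_paths \<alpha> n" and ?T = "tree_vertices \<alpha> n"
  let ?P = "path_vertices ?l"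
  \<comment> \<open>The labels are read off the true flow, not off the estimator, so the blocks are
    not random.\<close>
  define k where "k j v = nat \<lceil>\<mu> v / (2 * h j) - 1 / 2\<rceil>" for j v
  define \<nu> where "\<nu> v = (case v of Root \<Rightarrow> \<mu> Root
    | Node j i \<Rightarrow> if v \<in> ?T then 2 * h j * real (k j v) else 0)" for v
  have in_T: "Node j i \<in> ?T \<longleftrightarrow> j \<in> {1..?m} \<and> i \<in> {1..?l}" for j i
    by (auto simp: tree_vertices_def)
  have Root_T: "Root \<in> ?T" by (simp add: tree_vertices_def)
  have \<nu>_Root: "\<nu> Root = \<mu> Root" by (simp add: \<nu>_def)
  have \<nu>_Node: "\<nu> (Node j i) = 2 * h j * real (k j (Node j i))" if "j \<in> {1..?m}" "i \<in> {1..?l}" for j i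
    using that in_T by (simp add: \<nu>_def)
  have err: "\<bar>\<nu> (Node j i) - \<mu> (Node j i)\<bar> \<le> h j" and kq: "k j (Node j i) \<le> q j"
    if j: "j \<in> {1..?m}" and i: "i \<in> {1..?l}" for j i
  proof -
    have "0 \<le> \<mu> (Node j i)" "\<mu> (Node j i) \<le> (2 * real (q j) + 1) * h j"
      using flowsD[OF \<mu> j, of 1 i] i by (auto simp flip: q[OF j])
    from rounding_error[OF this h[OF j]]
    show "\<bar>\<nu> (Node j i) - \<mu> (Node j i)\<bar> \<le> h j" "k j (Node j i) \<le> q j"
      using \<nu>_Node[OF j i] by (auto simp: k_def)
  qed
  have \<nu>: "\<nu> \<in> flows \<alpha> n"
  proof -
    have "\<nu> v = 0" if "v \<notin> ?T" for v
      using that Root_T by (cases v) (auto simp: \<nu>_def)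
    moreover have "(\<Sum>j = 1..?m. \<nu> (Node j 1)) \<le> \<nu> Root"
    proof -
      \<comment> \<open>Rounding may raise values further down, but never the first one, since the
        top level lies \<open>h j\<close> below it or lower. This keeps the root constraint.\<close>
      have "\<nu> (Node j 1) \<le> \<mu> (Node j 1)" if j: "j \<in> {1..?m}" for j
      proof -
        have "2 * h j * real (k j (Node j 1)) \<le> 2 * h j * real (q j)"
          using kq[OF j, of 1] l h[OF j] by (intro mult_left_mono) auto
        then show ?thesis
          using \<nu>_Node[OF j, of 1] l h[OF j] q[OF j] by (simp add: algebra_simps)
      qed
      then have "(\<Sum>j = 1..?m. \<nu> (Node j 1)) \<le> (\<Sum>j = 1..?m. \<mu> (Node j 1))"
        by (rule sum_mono)
      also have "\<dots> \<le> \<mu> Root" by (rule flows_Root[OF \<mu>])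
      finally show ?thesis by (simp add: \<nu>_Root)
    qed
    moreover have "\<nu> (Node j (i + 1)) \<le> \<nu> (Node j i)" if j: "j \<in> {1..?m}" and i: "i \<in> {1..<?l}" for j i
    proof -
      have "\<mu> (Node j (i + 1)) \<le> \<mu> (Node j i)"
        using flowsD(1)[OF \<mu> j, of i "i + 1"] i by simp
      then have "k j (Node j (i + 1)) \<le> k j (Node j i)"
        unfolding k_def using h[OF j]
        by (intro nat_mono ceiling_mono diff_right_mono divide_right_mono) auto
      then show ?thesis
        using \<nu>_Node[OF j] i h[OF j] by (auto intro!: mult_left_mono)
    qed
    moreover have "0 \<le> \<nu> (Node j ?l)" if j: "j \<in> {1..?m}" for j
      using \<nu>_Node[OF j] l h[OF j] by auto
    ultimately show ?thesis by (simp add: flows_def)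
  qed
  have err_sum: "(\<Sum>v\<in>?T. (\<nu> v - \<mu> v)\<^sup>2) \<le> (\<Sum>j = 1..?m. real ?l * (h j)\<^sup>2)"
  proof -
    have "(\<Sum>i = 1..?l. (\<nu> (Node j i) - \<mu> (Node j i))\<^sup>2) \<le> real ?l * (h j)\<^sup>2" if j: "j \<in> {1..?m}" for j
    proof -
      have "(\<Sum>i = 1..?l. (\<nu> (Node j i) - \<mu> (Node j i))\<^sup>2) \<le> (\<Sum>i = 1..?l. (h j)\<^sup>2)"
        using err[OF j] by (intro sum_mono) (simp add: abs_le_square_iff[symmetric] h[OF j])
      then show ?thesis by simp
    qed
    then show ?thesis
      unfolding sum_tree_vertices \<nu>_Root by (auto intro!: sum_mono)
  qed
  let ?F = "\<lambda>j p. filter (\<lambda>v. k j v = p) (?P j)"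
  let ?G = "\<lambda>j \<omega>. (\<Sum>p\<le>q j. drift_area (map (\<lambda>v. X v \<omega>) (?F j p)))
      + (\<Sum>p = 1..q j. drift_area (map (\<lambda>v. - X v \<omega>) (rev (?F j p))))"
  have P: "distinct (?P j)" "set (?P j) \<subseteq> ?T" if "j \<in> {1..?m}" for j
    using that distinct_path_vertices path_vertices_subset by auto
  have mG: "?G j \<in> borel_measurable M" if "j \<in> {1..?m}" for j
    using P[OF that] by (intro borel_measurable_add borel_measurable_sum borel_measurable_drift_area_noise) auto
  have [measurable]: "X Root \<in> borel_measurable M"
    using Root_T by (rule measurable_noise)
  have EG: "integral\<^sup>N M (?G j) \<le> ennreal (\<sigma>\<^sup>2 * harm ?l * (real (q j) + 1 / 2))" if "j \<in> {1..?m}" for j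
    using nn_integral_levels_le[OF P[OF that], where q = "q j" and k = "k j"] by simp
  let ?E = "\<Sum>j = 1..?m. real ?l * (h j)\<^sup>2"
  have "(\<integral>\<^sup>+\<omega>. ennreal ((tree_norm \<alpha> n (\<lambda>v. lse \<alpha> n (\<lambda>u. \<mu> u + X u \<omega>) v - \<mu> v))\<^sup>2) \<partial>M)
      \<le> (\<integral>\<^sup>+\<omega>. ennreal ?E + (ennreal ((X Root \<omega>)\<^sup>2) + (\<Sum>j = 1..?m. ?G j \<omega>)) \<partial>M)"
  proof (rule nn_integral_mono)
    fix \<omega>
    let ?\<theta> = "lse \<alpha> n (\<lambda>u. \<mu> u + X u \<omega>)"
    let ?f = "\<lambda>v. 2 * X v \<omega> * (?\<theta> v - \<nu> v) - (?\<theta> v - \<nu> v)\<^sup>2"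
    have \<theta>: "?\<theta> \<in> flows \<alpha> n" by (rule lse_minimal)
    \<comment> \<open>Completing the square: an unconstrained deviation at the root gains at most
      the squared noise.\<close>
    have root: "?f Root \<le> (X Root \<omega>)\<^sup>2"
      using zero_le_power2[of "X Root \<omega> - (?\<theta> Root - \<nu> Root)"]
      by (simp add: power2_eq_square algebra_simps)
    have path: "ennreal (\<Sum>v\<leftarrow>?P j. ?f v) \<le> ?G j \<omega>" if j: "j \<in> {1..?m}" for j
    proof -
      have "(\<Sum>v\<leftarrow>?P j. ?f v)
          = (\<Sum>v\<leftarrow>?P j. 2 * X v \<omega> * (?\<theta> v - 2 * h j * real (k j v)) - (?\<theta> v - 2 * h j * real (k j v))\<^sup>2)"
        using \<nu>_Node[OF j] by (intro arg_cong[of _ _ sum_list] map_cong) (auto simp: set_path_vertices)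
      also have "ennreal \<dots> \<le> ?G j \<omega>"
        by (rule level_quadratic_le[where g = "\<lambda>p. 2 * h j * real p"])
           (use sorted_path_vertices[OF \<theta> j] flowsD(2)[OF \<theta> j] kq[OF j] in \<open>auto simp: set_path_vertices\<close>)
      finally show ?thesis .
    qed
    have "(tree_norm \<alpha> n (\<lambda>v. ?\<theta> v - \<mu> v))\<^sup>2 \<le> (\<Sum>v\<in>?T. (\<nu> v - \<mu> v)\<^sup>2) + (\<Sum>v\<in>?T. ?f v)"
      using lse_oracle[OF \<nu>, of \<mu> "\<lambda>u. X u \<omega>"] by simp
    also have "(\<Sum>v\<in>?T. ?f v) = ?f Root + (\<Sum>j = 1..?m. \<Sum>v\<leftarrow>?P j. ?f v)"
      unfolding sum_tree_vertices sum_list_path_vertices ..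
    also have "(\<Sum>v\<in>?T. (\<nu> v - \<mu> v)\<^sup>2) + \<dots> \<le> ?E + ((X Root \<omega>)\<^sup>2 + (\<Sum>j = 1..?m. \<Sum>v\<leftarrow>?P j. ?f v))"
      by (intro add_mono err_sum root order_refl)
    finally have "ennreal ((tree_norm \<alpha> n (\<lambda>v. ?\<theta> v - \<mu> v))\<^sup>2)
        \<le> ennreal (?E + ((X Root \<omega>)\<^sup>2 + (\<Sum>j = 1..?m. \<Sum>v\<leftarrow>?P j. ?f v)))"
      by (rule ennreal_leI)
    also have "\<dots> \<le> ennreal ?E + (ennreal ((X Root \<omega>)\<^sup>2) + ennreal (\<Sum>j = 1..?m. \<Sum>v\<leftarrow>?P j. ?f v))"
      by (intro order_trans[OF ennreal_add_le] add_left_mono ennreal_add_le)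
    also have "\<dots> \<le> ennreal ?E + (ennreal ((X Root \<omega>)\<^sup>2) + (\<Sum>j = 1..?m. ?G j \<omega>))"
      by (intro add_left_mono order_trans[OF ennreal_sum_le] sum_mono path)
    finally show "ennreal ((tree_norm \<alpha> n (\<lambda>v. ?\<theta> v - \<mu> v))\<^sup>2) \<le> \<dots>" .
  qed
  also have "\<dots> = ennreal ?E + (ennreal (\<sigma>\<^sup>2) + (\<Sum>j = 1..?m. integral\<^sup>N M (?G j)))"
  proof -
    have [measurable]: "(\<lambda>\<omega>. \<Sum>j = 1..?m. ?G j \<omega>) \<in> borel_measurable M"
      by (rule borel_measurable_sum) (rule mG)
    have "(\<integral>\<^sup>+\<omega>. ennreal ?E + (ennreal ((X Root \<omega>)\<^sup>2) + (\<Sum>j = 1..?m. ?G j \<omega>)) \<partial>M)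
        = ennreal ?E + ((\<integral>\<^sup>+\<omega>. ennreal ((X Root \<omega>)\<^sup>2) \<partial>M) + (\<integral>\<^sup>+\<omega>. (\<Sum>j = 1..?m. ?G j \<omega>) \<partial>M))"
      by (subst nn_integral_add, simp, measurable, subst nn_integral_add, measurable)
         (simp add: emeasure_space_1)
    also have "(\<integral>\<^sup>+\<omega>. (\<Sum>j = 1..?m. ?G j \<omega>) \<partial>M) = (\<Sum>j = 1..?m. integral\<^sup>N M (?G j))"
      by (rule nn_integral_sum) (rule mG)
    also have "(\<integral>\<^sup>+\<omega>. ennreal ((X Root \<omega>)\<^sup>2) \<partial>M) = ennreal (\<sigma>\<^sup>2)"
      using Root_T by (rule nn_integral_noise_square)
    finally show ?thesis .
  qed
  also have "\<dots> \<le> ennreal ?E + (ennreal (\<sigma>\<^sup>2) + (\<Sum>j = 1..?m. ennreal (\<sigma>\<^sup>2 * harm ?l * (real (q j) + 1 / 2))))"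
    by (intro add_left_mono sum_mono EG)
  also have "\<dots> = ennreal ?E + (ennreal (\<sigma>\<^sup>2) + ennreal (\<Sum>j = 1..?m. \<sigma>\<^sup>2 * harm ?l * (real (q j) + 1 / 2)))"
    by (subst sum_ennreal) (auto simp: harm_nonneg)
  also have "\<dots> = ennreal (?E + (\<sigma>\<^sup>2 + (\<Sum>j = 1..?m. \<sigma>\<^sup>2 * harm ?l * (real (q j) + 1 / 2))))"
    by (simp add: ennreal_plus sum_nonneg harm_nonneg)
  finally show ?thesis .
qed

end

text \<open>Each path contributes at most \<open>l\<close> times the square of its first value, and
  the sum of these squares is at most the square of their sum.\<close>

lemma flow_sum_squares_le:
  assumes "\<mu> \<in> flows \<alpha> n" "\<mu> Root \<le> V" and l: "1 \<le> path_length \<alpha> n"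
  shows "(\<Sum>v\<in>tree_vertices \<alpha> n. (\<mu> v)\<^sup>2) \<le> (real (path_length \<alpha> n) + 1) * V\<^sup>2"
proof -
  let ?l = "path_length \<alpha> n" and ?m = "num_paths \<alpha> n"
  let ?v = "\<lambda>j. \<mu> (Node j 1)"
  have v: "0 \<le> ?v j" if "j \<in> {1..?m}" for j
    using flowsD(2)[OF assms(1) that, of 1 1] l by simp
  have S: "0 \<le> sum ?v {1..?m}" "sum ?v {1..?m} \<le> \<mu> Root"
    using v flows_Root[OF assms(1)] by (auto intro: sum_nonneg)
  have V: "0 \<le> \<mu> Root" "0 \<le> V" using S assms(2) by auto
  have "(\<Sum>i = 1..?l. (\<mu> (Node j i))\<^sup>2) \<le> (\<Sum>i = 1..?l. ?v j * ?v j)" if "j \<in> {1..?m}" for j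
    unfolding power2_eq_square
    using flowsD[OF assms(1) that, of 1] v[OF that] by (intro sum_mono mult_mono) auto
  then have "(\<Sum>j = 1..?m. \<Sum>i = 1..?l. (\<mu> (Node j i))\<^sup>2) \<le> (\<Sum>j = 1..?m. real ?l * (?v j * ?v j))"
    by (intro sum_mono) simp
  also have "\<dots> \<le> (\<Sum>j = 1..?m. real ?l * (?v j * sum ?v {1..?m}))"
    using v by (intro sum_mono mult_left_mono member_le_sum) auto
  also have "\<dots> = real ?l * (sum ?v {1..?m} * sum ?v {1..?m})"
    by (simp only: sum_distrib_left[symmetric] sum_distrib_right[symmetric])
  also have "\<dots> \<le> real ?l * V\<^sup>2"
    unfolding power2_eq_square using S V assms(2) by (intro mult_left_mono mult_mono) auto
  finally have "(\<Sum>j = 1..?m. \<Sum>i = 1..?l. (\<mu> (Node j i))\<^sup>2) \<le> real ?l * V\<^sup>2" .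
  moreover have "(\<mu> Root)\<^sup>2 \<le> V\<^sup>2"
    using V assms(2) by (intro power_mono) auto
  ultimately show ?thesis
    unfolding sum_tree_vertices by (simp add: algebra_simps)
qed

text \<open>\<open>K\<close> is \<sigma>^2 log(e n), and \<open>\<tau>\<close> is scaled so that
  \<open>\<tau> * K / n\<close> is the 2/3 power in the final bound. The two competitors are
  separated by comparing \<open>V\<^sup>2 * l\<close> with \<open>K\<close>.\<close>

lemma (in tree_noise) risk_le:
  fixes V \<tau> :: real
  assumes \<alpha>: "0 \<le> \<alpha>" "\<alpha> \<le> 1" "1 \<le> n" and V: "0 \<le> V"
    and \<mu>: "\<mu> \<in> flows \<alpha> n" "\<mu> Root \<le> V"
  defines "K \<equiv> \<sigma>\<^sup>2 * (1 + ln (real n))"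
  assumes \<tau>: "0 \<le> \<tau>" "\<tau> ^ 3 = V\<^sup>2 * real n / K"
  shows "(\<integral>\<^sup>+\<omega>. ennreal ((tree_norm \<alpha> n (\<lambda>v. lse \<alpha> n (\<lambda>u. \<mu> u + X u \<omega>) v - \<mu> v))\<^sup>2) \<partial>M)
    \<le> ennreal ((2 * \<tau> + real n powr \<alpha>) * K)"
proof -
  define m where "m = num_paths \<alpha> n"
  define l where "l = path_length \<alpha> n"
  define a where "a = real n powr \<alpha>"
  note dim = tree_dimensions[OF \<alpha>, folded m_def l_def a_def]
  have L: "1 \<le> 1 + ln (real n)" using \<alpha> by simp
  then have K: "0 < K" using \<sigma>_pos by (simp add: K_def)
  have n: "0 < real n" "0 < real l" using \<alpha> dim by auto
  show ?thesis
  proof (cases "V\<^sup>2 * real l \<le> K")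
    case True
    \<comment> \<open>As \<open>z \<le> 1\<close> and \<open>l \<le> n\<close>, one has z^3 \<le> z
      \<le> \<tau>^3. The error of the zero fit is at most twice \<open>z * K\<close>, hence at most
      \<open>2 * \<tau> * K\<close>.\<close>
    define z where "z = V\<^sup>2 * real l / K"
    have z: "0 \<le> z" "z \<le> 1" using True K by (auto simp: z_def)
    have "z ^ 3 \<le> z ^ 1" using z by (intro power_decreasing) auto
    also have "z ^ 1 \<le> \<tau> ^ 3"
      unfolding z_def \<tau> power_one_right using dim K by (intro divide_right_mono mult_left_mono) auto
    finally have "z \<le> \<tau>" using \<tau>(1) power_le_imp_le_base[of z 2 \<tau>] by simp
    then have "z * K \<le> \<tau> * K" using K by (intro mult_right_mono) auto
    then have "V\<^sup>2 * real l \<le> \<tau> * K" using K by (simp add: z_def)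
    moreover have "(real l + 1) * V\<^sup>2 \<le> 2 * (V\<^sup>2 * real l)"
      using dim(2) mult_right_mono[of "real l + 1" "2 * real l" "V\<^sup>2"] by (simp add: algebra_simps)
    ultimately have 1: "(\<Sum>v\<in>tree_vertices \<alpha> n. (\<mu> v)\<^sup>2) \<le> 2 * \<tau> * K"
      using flow_sum_squares_le[OF \<mu>] dim(2) unfolding l_def by linarith
    have "\<sigma>\<^sup>2 * ((harm (Suc l) + (real m - 1) * harm l) / 2) \<le> \<sigma>\<^sup>2 * (a * (1 + ln (real n)))"
      using dim by (intro mult_left_mono zero_fit_cost) auto
    then have 2: "\<sigma>\<^sup>2 * ((harm (Suc l) + (real m - 1) * harm l) / 2) \<le> a * K"
      by (simp add: K_def mult.left_commute)
    have "(\<integral>\<^sup>+\<omega>. ennreal ((tree_norm \<alpha> n (\<lambda>v. lse \<alpha> n (\<lambda>u. \<mu> u + X u \<omega>) v - \<mu> v))\<^sup>2) \<partial>M)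
      \<le> ennreal ((\<Sum>v\<in>tree_vertices \<alpha> n. (\<mu> v)\<^sup>2) + \<sigma>\<^sup>2 * ((harm (Suc l) + (real m - 1) * harm l) / 2))"
      using risk_zero_fit[of \<mu>] dim unfolding m_def l_def by simp
    also have "\<dots> \<le> ennreal ((2 * \<tau> + a) * K)"
      using 1 2 by (intro ennreal_leI) (simp add: distrib_right)
    finally show ?thesis by (simp add: a_def)
  next
    case False
    have Vpos: "0 < V" using False K V by (cases "V = 0") auto
    have \<tau>1: "1 \<le> \<tau>"
    proof -
      have "1 ^ 3 \<le> V\<^sup>2 * real l / K" using False K by simp
      also have "\<dots> \<le> \<tau> ^ 3"
        unfolding \<tau> using dim K by (intro divide_right_mono mult_left_mono) auto
      finally show ?thesis using \<tau>(1) power_le_imp_le_base[of 1 2 \<tau>] by simp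
    qed
    define v where "v j = \<mu> (Node j 1)" for j
    define c where "c = real l / K"
    \<comment> \<open>In units of \<open>K\<close>, the rounding error and level count of path
      \<open>j\<close> become \<open>t j ^ 3 / (2 * q + 1)\<^sup>2 + q\<close>, the quantity of
      \<open>ex_rounding_level\<close>.\<close>
    define t where "t j = root 3 ((v j)\<^sup>2 * c)" for j
    define \<tau>\<^sub>0 where "\<tau>\<^sub>0 = root 3 (V\<^sup>2 * (real m * c))"
    have c: "0 < c" using n K by (simp add: c_def)
    have t: "0 \<le> t j" "t j ^ 3 = (v j)\<^sup>2 * c" for j
      using c by (auto simp: t_def)
    have \<tau>\<^sub>0: "0 < \<tau>\<^sub>0" "\<tau>\<^sub>0 ^ 3 = V\<^sup>2 * (real m * c)"
      using c Vpos dim(1) by (auto simp: \<tau>\<^sub>0_def)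
    have v: "0 \<le> v j" if "j \<in> {1..m}" for j
      using flowsD(2)[OF \<mu>(1), of j 1 1] that dim(2) by (simp add: v_def m_def l_def)
    have vV: "sum v {1..m} \<le> V"
      using flows_Root[OF \<mu>(1)] \<mu>(2) by (simp add: v_def m_def)
    have sum_t: "sum t {1..m} \<le> \<tau>\<^sub>0"
      by (rule sum_cube_roots_le[OF v vV Vpos _ t(2)]) (use c \<tau>\<^sub>0 in auto)
    have "\<exists>q::nat. t j ^ 3 / (2 * real q + 1)\<^sup>2 + real q \<le> 6 / 5 * t j" for j
      by (rule ex_rounding_level[OF t(1)])
    then obtain q :: "nat \<Rightarrow> nat" where q: "\<And>j. t j ^ 3 / (2 * real (q j) + 1)\<^sup>2 + real (q j) \<le> 6 / 5 * t j"
      by metis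
    define h where "h j = v j / (2 * real (q j) + 1)" for j
    have cost: "real l * (h j)\<^sup>2 + K * real (q j) \<le> K * (6 / 5 * t j)" for j
    proof -
      have "real l * (h j)\<^sup>2 = K * (t j ^ 3 / (2 * real (q j) + 1)\<^sup>2)"
        using K by (simp add: t(2) h_def c_def power_divide)
      then have "real l * (h j)\<^sup>2 + K * real (q j) = K * (t j ^ 3 / (2 * real (q j) + 1)\<^sup>2 + real (q j))"
        by (simp add: distrib_left)
      also have "\<dots> \<le> K * (6 / 5 * t j)"
        using K q by (intro mult_left_mono) auto
      finally show ?thesis .
    qed
    have "ln (real l) \<le> ln (real n)" using dim n by simp
    then have "harm l \<le> 1 + ln (real n)" using harm_le_ln[OF dim(2)] by linarith
    then have HK: "\<sigma>\<^sup>2 * harm l \<le> K" unfolding K_def by (rule mult_left_mono) simp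
    \<comment> \<open>\<open>\<tau>\<^sub>0\<close> is \<open>\<tau>\<close> with
      \<open>m * l\<close> in place of \<open>n\<close>; the ceilings enter only through this
      ratio.\<close>
    have ratio: "\<tau>\<^sub>0 ^ 3 = \<tau> ^ 3 * (real (m * l) / real n)"
      using n K by (simp add: \<tau>\<^sub>0(2) \<tau>(2) c_def)
    have "(\<Sum>j = 1..m. real l * (h j)\<^sup>2) + (\<sigma>\<^sup>2 + (\<Sum>j = 1..m. \<sigma>\<^sup>2 * harm l * (real (q j) + 1 / 2)))
        \<le> (\<Sum>j = 1..m. real l * (h j)\<^sup>2) + (\<sigma>\<^sup>2 + (\<Sum>j = 1..m. K * real (q j) + \<sigma>\<^sup>2 * harm l / 2))"
      using HK by (intro add_left_mono sum_mono) (simp add: distrib_left mult_right_mono)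
    also have "\<dots> = (\<Sum>j = 1..m. real l * (h j)\<^sup>2 + K * real (q j)) + \<sigma>\<^sup>2 * (1 + real m * harm l / 2)"
      by (simp add: sum.distrib algebra_simps)
    also have "\<dots> \<le> (\<Sum>j = 1..m. K * (6 / 5 * t j)) + \<sigma>\<^sup>2 * (1 + real m * harm l / 2)"
      by (intro add_right_mono sum_mono cost)
    also have "(\<Sum>j = 1..m. K * (6 / 5 * t j)) = K * (6 / 5 * sum t {1..m})"
      by (simp only: sum_distrib_left)
    also have "K * (6 / 5 * sum t {1..m}) + \<sigma>\<^sup>2 * (1 + real m * harm l / 2)
        \<le> K * (6 / 5 * \<tau>\<^sub>0) + \<sigma>\<^sup>2 * (1 + real m * harm l / 2)"
      using K sum_t by (intro add_right_mono mult_left_mono) auto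
    also have "\<dots> = \<sigma>\<^sup>2 * (6 / 5 * \<tau>\<^sub>0 * (1 + ln (real n)) + 1 + real m * harm l / 2)"
      by (simp add: K_def algebra_simps)
    also have "\<dots> \<le> \<sigma>\<^sup>2 * ((2 * \<tau> + a) * (1 + ln (real n)))"
      using dim \<tau>1 ratio by (intro mult_left_mono rounded_fit_cost) auto
    also have "\<dots> = (2 * \<tau> + a) * K"
      by (simp add: K_def)
    finally have bound: "(\<Sum>j = 1..m. real l * (h j)\<^sup>2)
        + (\<sigma>\<^sup>2 + (\<Sum>j = 1..m. \<sigma>\<^sup>2 * harm l * (real (q j) + 1 / 2))) \<le> (2 * \<tau> + a) * K" .
    have "(\<integral>\<^sup>+\<omega>. ennreal ((tree_norm \<alpha> n (\<lambda>v. lse \<alpha> n (\<lambda>u. \<mu> u + X u \<omega>) v - \<mu> v))\<^sup>2) \<partial>M)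
      \<le> ennreal ((\<Sum>j = 1..m. real l * (h j)\<^sup>2)
        + (\<sigma>\<^sup>2 + (\<Sum>j = 1..m. \<sigma>\<^sup>2 * harm l * (real (q j) + 1 / 2))))"
      unfolding m_def l_def
      by (rule risk_rounded_fit[OF \<mu>(1)])
         (use v dim(2) in \<open>auto simp: h_def v_def m_def l_def\<close>)
    also have "\<dots> \<le> ennreal ((2 * \<tau> + a) * K)"
      by (rule ennreal_leI[OF bound])
    finally show ?thesis by (simp add: a_def)
  qed
qed

text \<open>Stated for arbitrary \<open>f\<close>, as the loss has not been shown measurable. A
  simple function below \<open>c * f\<close>, divided by \<open>c\<close>, lies below
  \<open>f\<close>.\<close>

lemma nn_integral_cmult_le:
  assumes "0 < c"
  shows "(\<integral>\<^sup>+x. ennreal c * f x \<partial>M) \<le> ennreal c * (\<integral>\<^sup>+x. f x \<partial>M)"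
  unfolding nn_integral_def[of M "\<lambda>x. ennreal c * f x"]
proof (rule SUP_least)
  fix g assume "g \<in> {g. simple_function M g \<and> g \<le> (\<lambda>x. ennreal c * f x)}"
  then have g: "simple_function M g" "\<And>x. g x \<le> ennreal c * f x"
    by (auto simp: le_fun_def)
  have c: "ennreal c * ennreal (1 / c) = 1" "ennreal (1 / c) * ennreal c = 1"
    using assms by (auto simp flip: ennreal_mult)
  have "integral\<^sup>S M g = (\<integral>\<^sup>+x. ennreal c * (ennreal (1 / c) * g x) \<partial>M)"
    using g(1) by (simp add: nn_integral_eq_simple_integral c flip: mult.assoc)
  also have "\<dots> = ennreal c * (\<integral>\<^sup>+x. ennreal (1 / c) * g x \<partial>M)"
    using borel_measurable_simple_function[OF g(1)] by (intro nn_integral_cmult) measurable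
  also have "\<dots> \<le> ennreal c * (\<integral>\<^sup>+x. f x \<partial>M)"
  proof (intro mult_left_mono nn_integral_mono)
    fix x
    have "ennreal (1 / c) * g x \<le> ennreal (1 / c) * (ennreal c * f x)"
      by (intro mult_left_mono g) auto
    then show "ennreal (1 / c) * g x \<le> f x"
      by (simp add: c flip: mult.assoc)
  qed auto
  finally show "integral\<^sup>S M g \<le> ennreal c * integral\<^sup>N M f" .
qed

theorem theorem2p4:
  fixes M :: "'a measure" and \<epsilon> :: "vertex \<Rightarrow> 'a \<Rightarrow> real"
    and \<alpha> V \<sigma> :: real and n :: nat
  assumes "0 \<le> \<alpha>" and "\<alpha> \<le> 1" and "n \<ge> 1" and "V \<ge> 0" and "\<sigma> > 0"
    and "prob_space M"
    and "prob_space.indep_vars M (\<lambda>_. borel) \<epsilon> (tree_vertices \<alpha> n)"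
    and "\<And>v. v \<in> tree_vertices \<alpha> n \<Longrightarrow> distributed M lborel (\<epsilon> v) (normal_density 0 \<sigma>)"
  shows "(SUP \<mu> \<in> {\<mu> \<in> flows \<alpha> n. \<mu> Root \<le> V}.
            \<integral>\<^sup>+ \<omega>. ennreal (1 / real n *
              (tree_norm \<alpha> n (\<lambda>v. lse \<alpha> n (\<lambda>u. \<mu> u + \<epsilon> u \<omega>) v - \<mu> v))\<^sup>2) \<partial>M)
         \<le> ennreal (2 * (\<sigma>\<^sup>2 * V * ln (exp 1 * real n) / real n) powr (2 / 3)
                    + \<sigma>\<^sup>2 * ln (exp 1 * real n) / real n powr (1 - \<alpha>))"
proof (rule SUP_least)
  fix \<mu> assume "\<mu> \<in> {\<mu> \<in> flows \<alpha> n. \<mu> Root \<le> V}"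
  then have \<mu>: "\<mu> \<in> flows \<alpha> n" "\<mu> Root \<le> V" by auto
  interpret prob_space M by fact
  interpret tree_noise M \<epsilon> \<alpha> n \<sigma>
    by unfold_locales (use assms in auto)
  define K where "K = \<sigma>\<^sup>2 * (1 + ln (real n))"
  define x where "x = K * V / real n"
  \<comment> \<open>Chosen so that \<open>\<tau> * K / n = x powr (2 / 3)\<close>.\<close>
  define \<tau> where "\<tau> = real n * x powr (2 / 3) / K"
  have n: "0 < real n" using assms(3) by simp
  have "0 \<le> ln (real n)" using assms(3) by simp
  then have K: "0 < K" using assms(5) by (simp add: K_def)
  have x: "0 \<le> x" using K assms(4) n by (simp add: x_def)
  have \<tau>: "0 \<le> \<tau>" using K n by (simp add: \<tau>_def)
  have "(x powr (2 / 3)) ^ 3 = x\<^sup>2"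
    using x by (cases "x = 0") (auto simp: powr_power powr_numeral)
  then have "\<tau> ^ 3 = real n ^ 3 * x\<^sup>2 / K ^ 3"
    by (simp add: \<tau>_def power_mult_distrib power_divide)
  then have \<tau>3: "\<tau> ^ 3 = V\<^sup>2 * real n / K"
    using n K by (simp add: x_def power_mult_distrib power_divide power3_eq_cube power2_eq_square)
  have ln: "ln (exp 1 * real n) = 1 + ln (real n)"
    using n by (simp add: ln_mult)
  let ?N = "\<lambda>\<omega>. (tree_norm \<alpha> n (\<lambda>v. lse \<alpha> n (\<lambda>u. \<mu> u + \<epsilon> u \<omega>) v - \<mu> v))\<^sup>2"
  have "(\<integral>\<^sup>+\<omega>. ennreal (1 / real n * ?N \<omega>) \<partial>M) = (\<integral>\<^sup>+\<omega>. ennreal (1 / real n) * ennreal (?N \<omega>) \<partial>M)"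
    using n by (intro nn_integral_cong ennreal_mult) auto
  also have "\<dots> \<le> ennreal (1 / real n) * (\<integral>\<^sup>+\<omega>. ennreal (?N \<omega>) \<partial>M)"
    using n by (intro nn_integral_cmult_le) simp
  also have "\<dots> \<le> ennreal (1 / real n) * ennreal ((2 * \<tau> + real n powr \<alpha>) * K)"
    using risk_le[OF assms(1-4) \<mu> \<tau>] \<tau>3 unfolding K_def by (intro mult_left_mono) auto
  also have "\<dots> = ennreal (1 / real n * ((2 * \<tau> + real n powr \<alpha>) * K))"
    using n K \<tau> by (intro ennreal_mult[symmetric]) auto
  also have "1 / real n * ((2 * \<tau> + real n powr \<alpha>) * K) = 2 * x powr (2 / 3) + K * (real n powr \<alpha> / real n)"
    using n K by (simp add: \<tau>_def field_simps)
  also have "real n powr \<alpha> / real n = 1 / real n powr (1 - \<alpha>)"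
    using n by (simp add: powr_diff)
  finally show "(\<integral>\<^sup>+\<omega>. ennreal (1 / real n * ?N \<omega>) \<partial>M)
      \<le> ennreal (2 * (\<sigma>\<^sup>2 * V * ln (exp 1 * real n) / real n) powr (2 / 3)
          + \<sigma>\<^sup>2 * ln (exp 1 * real n) / real n powr (1 - \<alpha>))"
    unfolding ln x_def K_def by (simp add: mult_ac)
qed

end
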